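(* Let $J$ be an uncountable set and let $\varphi\in\mathcal S_{\mathbb P_J}(\mathrm{CAR}(J))$ be a symmetric state. Then $\varphi$ is an extreme point of $\mathcal S_{\mathbb P_J}(\mathrm{CAR}(J))$ if and only if $\varphi=\prod_J\rho$ for some even state $\rho$ on $\mathbb M_2(\mathbb C)$.
   Context: $\mathrm{CAR}(J)$ is the unital $C^*$-algebra generated by $\{a_j,a_j^\dagger : j\in J\}$ with $(a_j)^*=a_j^\dagger$, $\{a_j^\dagger,a_k\}=\delta_{jk}1$, $\{a_j,a_k\}=\{a_j^\dagger,a_k^\dagger\}=0$, where $\{a,b\}=ab+ba$. $\mathbb P_J$ is the group of permutations of $J$ moving only finitely many elements, acting on $\mathrm{CAR}(J)$ by the automorphisms $\alpha_g$ with $\alpha_g(a_j)=a_{gj}$. A state $\varphi$ is symmetric if $\varphi\circ\alpha_g=\varphi$ for all $g\in\mathbb P_J$; $\mathcal S_{\mathbb P_J}(\mathrm{CAR}(J))$ is the convex, $*$-weakly compact set of symmetric states. For each $j\in J$, $\iota_j:\mathbb M_2(\mathbb C)\to\mathrm{CAR}(J)$ is the embedding with range $\mathrm{CAR}(\{j\})$ sending the matrix units $e_{11},e_{12},e_{21},e_{22}$ to $a_ja_j^\dagger,a_j,a_j^\dagger,a_j^\dagger a_j$. A state on $\mathbb M_2(\mathbb C)$ is even if it is invariant under the grading inherited from $\mathrm{CAR}(\{j\})$ (the automorphism induced by $a_j\mapsto -a_j$), i.e. it vanishes on $e_{12},e_{21}$. For an even state $\rho$ on $\mathbb M_2(\mathbb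 C)$, the (Araki–Moriya) product state $\prod_J\rho$ is the unique state $\varphi$ on $\mathrm{CAR}(J)$ with $$\varphi(\iota_{j_1}(A_1)\cdots\iota_{j_n}(A_n))=\prod_{k=1}^n\rho(A_k)$$ for all distinct $j_1,\dots,j_n\in J$ and $A_1,\dots,A_n\in\mathbb M_2(\mathbb C)$. *)

theory Defs
  imports "HOL-Analysis.Analysis" "HOL-Combinatorics.Permutations"
begin

section \<open>Unital C*-algebras\<close>

class cstar_algebra = real_normed_algebra_1 + banach +
  fixes scaleC :: "complex \<Rightarrow> 'a \<Rightarrow> 'a" (infixr \<open>*\<^sub>C\<close> 75)
    and adj :: "'a \<Rightarrow> 'a"
  assumes scaleC_add_right: "c *\<^sub>C (x + y) = c *\<^sub>C x + c *\<^sub>C y"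
    and scaleC_add_left: "(c + d) *\<^sub>C x = c *\<^sub>C x + d *\<^sub>C x"
    and scaleC_scaleC: "c *\<^sub>C (d *\<^sub>C x) = (c * d) *\<^sub>C x"
    and scaleR_scaleC: "r *\<^sub>R x = complex_of_real r *\<^sub>C x"
    and norm_scaleC: "norm (c *\<^sub>C x) = cmod c * norm x"
    and mult_scaleC_left: "(c *\<^sub>C x) * y = c *\<^sub>C (x * y)"
    and mult_scaleC_right: "x * (c *\<^sub>C y) = c *\<^sub>C (x * y)"
    and adj_adj: "adj (adj x) = x"
    and adj_add: "adj (x + y) = adj x + adj y"
    and adj_scaleC: "adj (c *\<^sub>C x) = cnj c *\<^sub>C adj x"
    and adj_mult: "adj (x * y) = adj y * adj x"
    and cstar_identity: "norm (adj x * x) = (norm x)\<^sup>2"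

definition unital_cstar_subalgebra :: "'a::cstar_algebra set \<Rightarrow> bool" where
  "unital_cstar_subalgebra B \<longleftrightarrow>
     closed B \<and> 1 \<in> B \<and>
     (\<forall>x\<in>B. \<forall>y\<in>B. x + y \<in> B \<and> x * y \<in> B) \<and>
     (\<forall>c. \<forall>x\<in>B. c *\<^sub>C x \<in> B) \<and>
     (\<forall>x\<in>B. adj x \<in> B)"

text \<open>For C*-algebras preservation of the norm follows from the other conditions.\<close>

definition cstar_automorphism :: "('a::cstar_algebra \<Rightarrow> 'a) \<Rightarrow> bool" where
  "cstar_automorphism \<alpha> \<longleftrightarrow>
     bij \<alpha> \<and>
     (\<forall>x y. \<alpha> (x + y) = \<alpha> x + \<alpha> y \<and> \<alpha> (x * y) = \<alpha> x * \<alpha> y) \<and>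
     (\<forall>c x. \<alpha> (c *\<^sub>C x) = c *\<^sub>C \<alpha> x) \<and>
     (\<forall>x. \<alpha> (adj x) = adj (\<alpha> x)) \<and>
     (\<forall>x. norm (\<alpha> x) = norm x)"

text \<open>
  Elements of \<open>'a \<Rightarrow>\<^sub>L complex\<close> are the bounded real-linear functionals, so that
  complex homogeneity has to be required separately. Boundedness is no restriction, since
  positive linear functionals on a C*-algebra are bounded; having states in this real vector
  space makes the library notion of extreme point applicable to sets of states.
\<close>

definition states :: "('a::cstar_algebra \<Rightarrow>\<^sub>L complex) set" where
  "states = {\<phi>. (\<forall>c x. blinfun_apply \<phi> (c *\<^sub>C x) = c * blinfun_apply \<phi> x) \<and>
                (\<forall>x. blinfun_apply \<phi> (adj x * x) \<in> \<real>\<^sub>\<ge>\<^sub>0) \<and>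
                blinfun_apply \<phi> 1 = 1}"

section \<open>The CAR algebra\<close>

definition anticomm :: "'a::ring \<Rightarrow> 'a \<Rightarrow> 'a" where
  "anticomm x y = x * y + y * x"

text \<open>
  \<open>CAR J a\<close> states that the ambient C*-algebra (the whole type) is \<open>CAR(J)\<close> with annihilators
  \<open>a j\<close>, \<open>j \<in> J\<close>; values of \<open>a\<close> outside \<open>J\<close> are irrelevant. A unital C*-algebra
  generated by elements satisfying the canonical anticommutation relations is unique up to a
  unique generator-preserving isomorphism.
\<close>

definition CAR :: "'j set \<Rightarrow> ('j \<Rightarrow> 'a::cstar_algebra) \<Rightarrow> bool" where
  "CAR J a \<longleftrightarrow>
     (\<forall>j\<in>J. \<forall>k\<in>J. anticomm (adj (a j)) (a k) = (if j = k then 1 else 0) \<and>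
        anticomm (a j) (a k) = 0 \<and> anticomm (adj (a j)) (adj (a k)) = 0) \<and>
     unital_cstar_subalgebra hull (a ` J) = UNIV"

definition finitary_permutations :: "'j set \<Rightarrow> ('j \<Rightarrow> 'j) set" where
  "finitary_permutations J = {g. g permutes J \<and> finite {j. g j \<noteq> j}}"

text \<open>
  If \<open>CAR J a\<close> and \<open>g\<close> is a finitary permutation of \<open>J\<close>, exactly one such automorphism exists.
  The transposition of \<open>j\<close> and \<open>k\<close> is implemented by the self-adjoint unitary
  \<open>1 - (a\<^sub>j - a\<^sub>k)\<^sup>\<dagger>(a\<^sub>j - a\<^sub>k)\<close>.
\<close>

definition car_perm :: "'j set \<Rightarrow> ('j \<Rightarrow> 'a::cstar_algebra) \<Rightarrow> ('j \<Rightarrow> 'j) \<Rightarrow> 'a \<Rightarrow> 'a" where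
  "car_perm J a g = (THE \<alpha>. cstar_automorphism \<alpha> \<and> (\<forall>j\<in>J. \<alpha> (a j) = a (g j)))"

definition symmetric_states ::
    "'j set \<Rightarrow> ('j \<Rightarrow> 'a::cstar_algebra) \<Rightarrow> ('a \<Rightarrow>\<^sub>L complex) set" where
  "symmetric_states J a =
     {\<phi> \<in> states. \<forall>g \<in> finitary_permutations J. blinfun_apply \<phi> \<circ> car_perm J a g = blinfun_apply \<phi>}"

section \<open>Even states on two-by-two matrices and product states\<close>

definition matrix_adj :: "complex^2^2 \<Rightarrow> complex^2^2" where
  "matrix_adj A = map_matrix cnj (transpose A)"

definition matrix_state :: "(complex^2^2 \<Rightarrow> complex) \<Rightarrow> bool" where
  "matrix_state \<rho> \<longleftrightarrow>
     (\<forall>A B. \<rho> (A + B) = \<rho> A + \<rho> B) \<and>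
     (\<forall>c A. \<rho> (map_matrix ((*) c) A) = c * \<rho> A) \<and>
     (\<forall>A. \<rho> (matrix_adj A ** A) \<in> \<real>\<^sub>\<ge>\<^sub>0) \<and>
     \<rho> (mat 1) = 1"

definition car_embed :: "('j \<Rightarrow> 'a::cstar_algebra) \<Rightarrow> 'j \<Rightarrow> complex^2^2 \<Rightarrow> 'a" where
  "car_embed a j A =
     A$1$1 *\<^sub>C (a j * adj (a j)) + A$1$2 *\<^sub>C a j +
     A$2$1 *\<^sub>C adj (a j) + A$2$2 *\<^sub>C (adj (a j) * a j)"

text \<open>
  The automorphism of \<open>CAR({j})\<close> induced by \<open>a\<^sub>j \<mapsto> - a\<^sub>j\<close>, transported to matrices along
  \<open>car_embed a j\<close>: it fixes the diagonal matrix units and negates the off-diagonal ones.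
\<close>

definition matrix_grading :: "complex^2^2 \<Rightarrow> complex^2^2" where
  "matrix_grading A = (\<chi> i k. if i = k then A$i$k else - A$i$k)"

definition even_matrix_state :: "(complex^2^2 \<Rightarrow> complex) \<Rightarrow> bool" where
  "even_matrix_state \<rho> \<longleftrightarrow> matrix_state \<rho> \<and> \<rho> \<circ> matrix_grading = \<rho>"

text \<open>
  \<open>is_product_state J a \<rho> \<phi>\<close> means \<open>\<phi> = \<Prod>\<^sub>J \<rho>\<close>. The condition determines \<open>\<phi>\<close>, because the
  products occurring in it span a dense subspace.
\<close>

definition is_product_state ::
    "'j set \<Rightarrow> ('j \<Rightarrow> 'a::cstar_algebra) \<Rightarrow> (complex^2^2 \<Rightarrow> complex) \<Rightarrow> ('a \<Rightarrow>\<^sub>L complex) \<Rightarrow> bool" where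
  "is_product_state J a \<rho> \<phi> \<longleftrightarrow> \<phi> \<in> states \<and>
     (\<forall>js As. distinct js \<and> set js \<subseteq> J \<and> length As = length js \<longrightarrow>
        blinfun_apply \<phi> (prod_list (map2 (car_embed a) js As)) = prod_list (map \<rho> As))"

end

theory Submission
  imports Defs
begin

text \<open>
  A monomial is a product of elements of the matrix copies at distinct sites. The monomials span a
  dense subspace, and symmetric states are exactly the states whose value on a monomial does not
  depend on the sites (transpositions are implemented by unitaries, and there are always fresh
  sites).

  If a symmetric state is dominated by a multiple of a product state, average \<open>n\<close> disjoint
  copies of a monomial, centred by its value in the product state. The copies are uncorrelated, so
  Cauchy--Schwarz forces the two states to agree on the monomial. Hence product states are extreme.

  Conversely, let \<open>\<phi>\<close> be extreme. A trailing factor \<open>a\<^sub>k\<close> or its adjoint can be averaged over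
  \<open>n\<close> sites, and the anticommutation relations bound the second moment of the sum by \<open>n\<close>, so
  \<open>\<phi>\<close> vanishes on such monomials. A trailing diagonal projection \<open>D\<close>, pushed out to infinity,
  cuts \<open>\<phi>\<close> down to a positive symmetric functional; the cut-downs by \<open>D\<close> and \<open>1 - D\<close> add up to
  \<open>\<phi>\<close>, so by extremality each is a multiple of \<open>\<phi>\<close>. Thus \<open>\<phi>\<close> factors off the last site of every
  monomial.
\<close>

subsection \<open>Scalars, adjoints and positive functionals\<close>

lemma scaleC_one [simp]: "1 *\<^sub>C (x::'a::cstar_algebra) = x"
  using scaleR_scaleC[of 1 x] by simp

lemma scaleC_zero_left [simp]: "0 *\<^sub>C (x::'a::cstar_algebra) = 0"
  using scaleR_scaleC[of 0 x] by simp

lemma scaleC_zero_right [simp]: "c *\<^sub>C (0::'a::cstar_algebra) = 0"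
  using scaleC_add_right[of c 0 0] by simp

lemma scaleC_minus_right: "c *\<^sub>C (- x) = - (c *\<^sub>C (x::'a::cstar_algebra))"
  using scaleC_add_right[of c "- x" x] by (simp add: eq_neg_iff_add_eq_0)

lemma scaleC_minus_left: "(- c) *\<^sub>C x = - (c *\<^sub>C (x::'a::cstar_algebra))"
  using scaleC_add_left[of "- c" c x] by (simp add: eq_neg_iff_add_eq_0)

lemma scaleC_diff_right: "c *\<^sub>C (x - y) = c *\<^sub>C x - c *\<^sub>C (y::'a::cstar_algebra)"
  using scaleC_add_right[of c x "- y"] by (simp add: scaleC_minus_right)

lemma adj_zero [simp]: "adj (0::'a::cstar_algebra) = 0"
  using adj_add[of 0 0] by simp

lemma adj_minus: "adj (- x) = - adj (x::'a::cstar_algebra)"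
  using adj_add[of "- x" x] by (simp add: eq_neg_iff_add_eq_0)

lemma adj_diff: "adj (x - y) = adj x - adj (y::'a::cstar_algebra)"
  using adj_add[of x "- y"] by (simp add: adj_minus)

lemma adj_one [simp]: "adj (1::'a::cstar_algebra) = 1"
  using adj_mult[of "adj 1" "1::'a"] by (simp add: adj_adj)

lemma adj_sum: "adj (sum f A) = (\<Sum>i\<in>A. adj (f i :: 'a::cstar_algebra))"
  by (induction A rule: infinite_finite_induct) (auto simp: adj_add)

text \<open>The C*-identity and submultiplicativity bound the square of \<open>norm x\<close> by
  \<open>norm (adj x) * norm x\<close>; one factor cancels.\<close>

lemma norm_le_norm_adj: "norm (x::'a::cstar_algebra) \<le> norm (adj x)"
proof (cases "norm x = 0")
  case False
  have "norm x * norm x \<le> norm (adj x) * norm x"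
    using cstar_identity[of x] norm_mult_ineq[of "adj x" x] by (simp add: power2_eq_square)
  with False show ?thesis by simp
qed auto

lemma norm_adj [simp]: "norm (adj x) = norm (x::'a::cstar_algebra)"
  using norm_le_norm_adj[of x] norm_le_norm_adj[of "adj x"] by (simp add: adj_adj)

lemma bounded_linear_adj: "bounded_linear (adj :: 'a::cstar_algebra \<Rightarrow> 'a)"
  by (intro bounded_linear_intro[where K=1]) (auto simp: adj_add scaleR_scaleC adj_scaleC)

lemma norm_projection_le_1:
  fixes d :: "'a::cstar_algebra"
  assumes "adj d = d" "d * d = d"
  shows "norm d \<le> 1"
  using cstar_identity[of d] assms by (auto simp: power2_eq_square)

section \<open>Positive functionals, Cauchy-Schwarz and averaging\<close>

text \<open>No normalisation is imposed, so that cutting a state down by a projection stays within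
  the notion.\<close>

definition positive_functional :: "('a::cstar_algebra \<Rightarrow>\<^sub>L complex) \<Rightarrow> bool" where
  "positive_functional f \<longleftrightarrow> (\<forall>c x. f (c *\<^sub>C x) = c * f x) \<and> (\<forall>x. f (adj x * x) \<in> \<real>\<^sub>\<ge>\<^sub>0)"

lemma states_eq: "states = {f. positive_functional f \<and> blinfun_apply f 1 = 1}"
  by (auto simp: states_def positive_functional_def)

lemma positive_functional_scaleC: "positive_functional f \<Longrightarrow> f (c *\<^sub>C x) = c * f x"
  by (simp add: positive_functional_def)

lemma positive_functional_Re_nonneg: "positive_functional f \<Longrightarrow> 0 \<le> Re (f (adj x * x))"
  by (auto simp: positive_functional_def complex_nonneg_Reals_iff)

lemma positive_functional_Im: "positive_functional f \<Longrightarrow> Im (f (adj x * x)) = 0"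
  by (auto simp: positive_functional_def complex_nonneg_Reals_iff)

text \<open>Polarisation: the values at \<open>x + y\<close> and at \<open>x + \<i> y\<close> are
  real, which fixes the imaginary and the real part respectively.\<close>

lemma positive_functional_hermitian:
  assumes f: "positive_functional f"
  shows "f (adj y * x) = cnj (f (adj x * y))"
proof -
  have expand: "f (adj (x + c *\<^sub>C y) * (x + c *\<^sub>C y)) = f (adj x * x) + c * f (adj x * y)
      + cnj c * f (adj y * x) + cnj c * c * f (adj y * y)" for c
    by (simp add: adj_add adj_scaleC algebra_simps mult_scaleC_left mult_scaleC_right
        blinfun.add_right positive_functional_scaleC[OF f] scaleC_scaleC scaleC_add_right)
  note im = positive_functional_Im[OF f]
  have "Im (f (adj x * y)) + Im (f (adj y * x)) = 0"
    using im[of "x + 1 *\<^sub>C y"] im[of x] im[of y] unfolding expand by simp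
  moreover have "Re (f (adj x * y)) - Re (f (adj y * x)) = 0"
    using im[of "x + \<i> *\<^sub>C y"] im[of x] im[of y] unfolding expand by simp
  ultimately show ?thesis by (simp add: complex_eq_iff)
qed

lemma positive_functional_Cauchy_Schwarz:
  assumes f: "positive_functional f"
  shows "(cmod (f (adj x * y)))\<^sup>2 \<le> Re (f (adj x * x)) * Re (f (adj y * y))"
proof -
  define F where "F = f (adj x * y)"
  define a b where "a = Re (f (adj x * x))" and "b = Re (f (adj y * y))"
  have a: "f (adj x * x) = of_real a" and b: "f (adj y * y) = of_real b"
    using positive_functional_Im[OF f] by (auto simp: a_def b_def complex_eq_iff)
  have yx: "f (adj y * x) = cnj F"
    unfolding F_def by (rule positive_functional_hermitian[OF f])
  have ab: "a \<ge> 0" "b \<ge> 0" by (auto simp: a_def b_def positive_functional_Re_nonneg[OF f])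
  define N where "N = (cmod F)\<^sup>2"
  have FN: "F * cnj F = of_real N" unfolding N_def by (simp add: complex_norm_square[symmetric])
  have main: "0 \<le> a - 2 * t * N + t\<^sup>2 * N * b" for t :: real
  proof -
    \<comment> \<open>The factor \<open>cnj F\<close> makes both cross terms equal to
      \<open>- t * N\<close>, so positivity becomes a real quadratic inequality in
      \<open>t\<close>.\<close>
    define c where "c = - of_real t * cnj F"
    have "f (adj (x + c *\<^sub>C y) * (x + c *\<^sub>C y)) = f (adj x * x) + c * f (adj x * y)
      + cnj c * f (adj y * x) + cnj c * c * f (adj y * y)"
      by (simp add: adj_add adj_scaleC algebra_simps mult_scaleC_left mult_scaleC_right
          blinfun.add_right positive_functional_scaleC[OF f] scaleC_scaleC scaleC_add_right)
    also have "\<dots> = of_real a - 2 * of_real t * (F * cnj F) + (of_real t)\<^sup>2 * (F * cnj F) * of_real b"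
      by (simp add: a b yx c_def F_def[symmetric] algebra_simps power2_eq_square)
    also have "\<dots> = of_real (a - 2 * t * N + t\<^sup>2 * N * b)"
      by (simp add: FN)
    finally show ?thesis
      using positive_functional_Re_nonneg[OF f, of "x + c *\<^sub>C y"] by simp
  qed
  have "N \<le> a * b"
  proof (cases "N = 0")
    case True
    then show ?thesis using ab by simp
  next
    case False
    then have N: "N > 0" by (simp add: N_def)
    show ?thesis
    proof (cases "b = 0")
      case True
      \<comment> \<open>For \<open>b = 0\<close> the quadratic is affine in \<open>t\<close>, and
        this value of \<open>t\<close> makes it -1.\<close>
      then show ?thesis using main[of "(a + 1) / (2 * N)"] N by simp
    next
      case False
      then have "b > 0" using ab by simp
      \<comment> \<open>The choice \<open>t = 1 / b\<close> minimises the quadratic.\<close>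
      then have "0 \<le> a - N / b"
        using main[of "1 / b"] by (simp add: power2_eq_square field_simps)
      then show ?thesis using \<open>b > 0\<close> by (simp add: field_simps)
    qed
  qed
  then show ?thesis by (simp add: N_def F_def a_def b_def)
qed

text \<open>Cauchy-Schwarz for \<open>w\<close> and the sum of \<open>n\<close> terms compares a
  left side quadratic in \<open>n\<close> with a right side linear in \<open>n\<close>, which is
  possible for all \<open>n\<close> only if \<open>c = 0\<close>.\<close>

lemma averaging:
  fixes z :: "nat \<Rightarrow> 'a::cstar_algebra" and C :: real
  assumes g: "positive_functional g"
    and dom: "\<And>x. Re (g (adj x * x)) \<le> K * Re (f (adj x * x))" and K: "K \<ge> 0"
    and bound: "\<And>n. Re (f (adj (\<Sum>i<n. z i) * (\<Sum>i<n. z i))) \<le> C * n"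
    and const: "\<And>i. g (adj w * z i) = c"
  shows "c = 0"
proof -
  define G where "G = Re (g (adj w * w))"
  have G: "G \<ge> 0" by (simp add: G_def positive_functional_Re_nonneg[OF g])
  have est: "real n * (cmod c)\<^sup>2 \<le> G * (K * C)" if "n > 0" for n :: nat
  proof -
    let ?y = "\<Sum>i<n. z i"
    have "g (adj w * ?y) = of_nat n * c"
      by (simp add: sum_distrib_left blinfun.sum_right const)
    then have "(real n * cmod c)\<^sup>2 \<le> G * Re (g (adj ?y * ?y))"
      using positive_functional_Cauchy_Schwarz[OF g, of w ?y] by (simp add: G_def norm_mult)
    also have "\<dots> \<le> G * (K * (C * n))"
      by (intro mult_left_mono[OF order_trans[OF dom]] mult_left_mono bound G K)
    finally have "real n * (real n * (cmod c)\<^sup>2) \<le> real n * (G * (K * C))"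
      by (simp add: power2_eq_square algebra_simps)
    then show ?thesis using that by simp
  qed
  show ?thesis
  proof (rule ccontr)
    assume "c \<noteq> 0"
    then have c: "(cmod c)\<^sup>2 > 0" by simp
    then obtain n :: nat where n: "G * (K * C) < real n * (cmod c)\<^sup>2"
      using reals_Archimedean3 by blast
    \<comment> \<open>The estimate needs a positive index, while the Archimedean \<open>n\<close> is
      not known to be positive.\<close>
    have "real (Suc n) * (cmod c)\<^sup>2 \<le> G * (K * C)" by (rule est) simp
    moreover have "real n * (cmod c)\<^sup>2 \<le> real (Suc n) * (cmod c)\<^sup>2"
      using c by (intro mult_right_mono) auto
    ultimately show False using n by linarith
  qed
qed

subsection \<open>Monomials in the matrix copies\<close>

lemma matrix_grading_grading [simp]: "matrix_grading (matrix_grading A) = A"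
  by (simp add: matrix_grading_def vec_eq_iff)

locale car =
  fixes J :: "'j set" and a :: "'j \<Rightarrow> 'a::cstar_algebra"
  assumes car: "CAR J a" and infinite_J: "infinite J"
begin

abbreviation num :: "'j \<Rightarrow> 'a" where "num j \<equiv> adj (a j) * a j"

text \<open>Lists record the order of the factors, which matters because off-diagonal elements at
  different sites anticommute. \<open>map2\<close> truncates to the shorter list, hence the length
  hypotheses below.\<close>

definition mon :: "'j list \<Rightarrow> (complex^2^2) list \<Rightarrow> 'a" where
  "mon js As = prod_list (map2 (car_embed a) js As)"

lemma mon_Nil [simp]: "mon [] As = 1"
  by (simp add: mon_def)

lemma mon_Cons [simp]: "mon (j # js) (A # As) = car_embed a j A * mon js As"
  by (simp add: mon_def)

lemma mon_append:
  "length js = length As \<Longrightarrow> mon (js @ js') (As @ As') = mon js As * mon js' As'"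
  by (simp add: mon_def)

section \<open>Consequences of the anticommutation relations\<close>

lemma anticomm_adj:
  assumes "j \<in> J" "k \<in> J"
  shows "adj (a j) * a k + a k * adj (a j) = (if j = k then 1 else 0)"
  using car assms by (simp add: CAR_def anticomm_def)

lemma anticomm_same:
  assumes "j \<in> J" "k \<in> J"
  shows "a j * a k + a k * a j = 0" "adj (a j) * adj (a k) + adj (a k) * adj (a j) = 0"
  using car assms by (auto simp: CAR_def anticomm_def)

text \<open>Each generator anticommutes with itself, so twice its square is 0. The versions with a
  trailing \<open>x\<close> rewrite inside right-nested products.\<close>

lemma square_zero [simp]:
  assumes "j \<in> J"
  shows "a j * a j = 0" "adj (a j) * adj (a j) = 0" "a j * (a j * x) = 0"
    "adj (a j) * (adj (a j) * x) = 0"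
proof -
  have *: "x = 0" if "x + x = 0" for x :: 'a
  proof -
    have "2 *\<^sub>R x = 0" using that by (simp add: scaleR_2)
    then show ?thesis by simp
  qed
  show 1: "a j * a j = 0" "adj (a j) * adj (a j) = 0"
    using anticomm_same[OF assms assms] * by blast+
  then show "a j * (a j * x) = 0" "adj (a j) * (adj (a j) * x) = 0"
    by (simp_all add: mult.assoc[symmetric])
qed

text \<open>Substituting \<open>1 - a j * adj (a j)\<close> for \<open>num j\<close>, or conversely,
  leaves a term killed by nilpotency: the generators are partial isometries.\<close>

lemma a_adj_a [simp]:
  assumes "j \<in> J"
  shows "a j * (adj (a j) * a j) = a j" "adj (a j) * (a j * adj (a j)) = adj (a j)"
    "a j * (adj (a j) * (a j * x)) = a j * x"
    "adj (a j) * (a j * (adj (a j) * x)) = adj (a j) * x"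
proof -
  have 1: "adj (a j) * a j = 1 - a j * adj (a j)" "a j * adj (a j) = 1 - adj (a j) * a j"
    using anticomm_adj[OF assms assms] by (auto simp: algebra_simps)
  show 2: "a j * (adj (a j) * a j) = a j"
    unfolding 1(1) using assms by (simp add: algebra_simps)
  show 3: "adj (a j) * (a j * adj (a j)) = adj (a j)"
    unfolding 1(2) using assms by (simp add: algebra_simps)
  show "a j * (adj (a j) * (a j * x)) = a j * x"
    "adj (a j) * (a j * (adj (a j) * x)) = adj (a j) * x"
    using arg_cong[OF 2, of "\<lambda>y. y * x"] arg_cong[OF 3, of "\<lambda>y. y * x"]
    by (simp_all add: mult.assoc)
qed

lemma anticommuting:
  assumes "j \<in> J" "k \<in> J" "j \<noteq> k" "b = a k \<or> b = adj (a k)"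
  shows "b * a j = - (a j * b)" "b * adj (a j) = - (adj (a j) * b)"
  using assms anticomm_adj[of j k] anticomm_adj[of k j] anticomm_same[of j k] anticomm_same[of k j]
  by (auto simp: eq_neg_iff_add_eq_0 add.commute)

lemma num_idem:
  assumes "j \<in> J" shows "num j * num j = num j"
  using assms by (simp add: mult.assoc)

lemma adj_num [simp]: "adj (num j) = num j"
  by (simp add: adj_mult adj_adj)

text \<open>\<open>num j\<close> is a projection, and by the C*-identity its norm is the square of
  \<open>norm (a j)\<close>.\<close>

lemma norm_a_le:
  assumes "j \<in> J" shows "norm (a j) \<le> 1"
proof -
  have "norm (a j) ^ 2 \<le> 1"
    unfolding cstar_identity[symmetric]
    by (intro norm_projection_le_1) (simp_all add: num_idem assms del: a_adj_a)
  then show ?thesis by (simp add: power_le_one_iff abs_square_le_1)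
qed

text \<open>The four images satisfy the multiplication table of the matrix units, by nilpotency and
  the partial isometry relations.\<close>

lemma embed_mult:
  assumes "j \<in> J"
  shows "car_embed a j A * car_embed a j B = car_embed a j (A ** B)"
  using assms
  by (simp add: car_embed_def matrix_matrix_mult_def sum_2 mult_scaleC_left mult_scaleC_right
      scaleC_scaleC scaleC_add_left scaleC_add_right algebra_simps)

lemma embed_add: "car_embed a j (A + B) = car_embed a j A + car_embed a j B"
  by (simp add: car_embed_def scaleC_add_left algebra_simps)

lemma embed_scaleC: "car_embed a j (map_matrix ((*) c) A) = c *\<^sub>C car_embed a j A"
  by (simp add: car_embed_def scaleC_add_right scaleC_scaleC map_matrix_def)

lemma embed_adj: "adj (car_embed a j A) = car_embed a j (matrix_adj A)"
  by (simp add: car_embed_def matrix_adj_def adj_add adj_scaleC adj_mult adj_adj transpose_def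
      map_matrix_def)

lemma embed_one:
  assumes "j \<in> J" shows "car_embed a j (mat 1) = 1"
  using anticomm_adj[OF assms assms] by (simp add: car_embed_def mat_def add.commute)

lemma embed_units:
  "car_embed a j (vector [vector [0, 1], vector [0, 0]]) = a j"
  "car_embed a j (vector [vector [0, 0], vector [1, 0]]) = adj (a j)"
  "car_embed a j (vector [vector [0, 0], vector [0, 1]]) = num j"
  "car_embed a j (vector [vector [1, 0], vector [0, 0]]) = a j * adj (a j)"
  by (simp_all add: car_embed_def)

text \<open>A crude bound, whose point is that it does not depend on the site.\<close>

lemma norm_embed_le:
  assumes "j \<in> J"
  shows "norm (car_embed a j A) \<le> cmod (A$1$1) + cmod (A$1$2) + cmod (A$2$1) + cmod (A$2$2)"
proof -
  have n: "norm (a j) \<le> 1" "norm (adj (a j)) \<le> 1" using norm_a_le[OF assms] by auto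
  then have n2: "norm (a j * adj (a j)) \<le> 1" "norm (num j) \<le> 1"
    by (auto intro!: order_trans[OF norm_mult_ineq] mult_le_one)
  have *: "norm (c *\<^sub>C x) \<le> cmod c" if "norm x \<le> 1" for c and x :: 'a
    using that by (simp add: norm_scaleC mult_left_le)
  show ?thesis unfolding car_embed_def
    by (intro norm_triangle_le add_mono * n n2)
qed

text \<open>Passing a generator of another site costs a sign on each odd factor and none on the even
  ones, which is what the grading records.\<close>

lemma grading_commute:
  assumes "j \<in> J" "k \<in> J" "j \<noteq> k" "b = a k \<or> b = adj (a k)"
  shows "b * car_embed a j A = car_embed a j (matrix_grading A) * b"
proof -
  note b = anticommuting[OF assms]
  have b': "b * (a j * x) = - (a j * (b * x))" "b * (adj (a j) * x) = - (adj (a j) * (b * x))" for x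
    using arg_cong[OF b(1), of "\<lambda>y. y * x"] arg_cong[OF b(2), of "\<lambda>y. y * x"]
    by (simp_all add: mult.assoc)
  show ?thesis
    by (simp add: car_embed_def matrix_grading_def distrib_left distrib_right mult_scaleC_left
        mult_scaleC_right mult.assoc b b' scaleC_minus_right scaleC_minus_left
        left_diff_distrib)
qed

text \<open>\<open>num k\<close> consists of two generators, so the grading is applied twice and
  cancels.\<close>

lemma num_commute_embed:
  assumes "j \<in> J" "k \<in> J" "j \<noteq> k"
  shows "num k * car_embed a j A = car_embed a j A * num k"
proof -
  have "num k * car_embed a j A = adj (a k) * (a k * car_embed a j A)"
    by (simp add: mult.assoc)
  also have "\<dots> = (adj (a k) * car_embed a j (matrix_grading A)) * a k"
    using grading_commute[OF assms, of "a k"] by (simp add: mult.assoc)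
  also have "\<dots> = car_embed a j A * num k"
    using grading_commute[OF assms, of "adj (a k)"] by (simp add: mult.assoc)
  finally show ?thesis .
qed

lemma num_commute_mon:
  assumes "length js = length As" "set js \<subseteq> J" "k \<in> J" "k \<notin> set js"
  shows "num k * mon js As = mon js As * num k"
  using assms
proof (induction js As rule: list_induct2)
  case (Cons j js A As)
  have "num k * mon (j # js) (A # As) = (num k * car_embed a j A) * mon js As"
    by (simp add: mult.assoc)
  also have "\<dots> = car_embed a j A * (num k * mon js As)"
    by (subst num_commute_embed) (use Cons.prems in \<open>auto simp: mult.assoc\<close>)
  also have "\<dots> = mon (j # js) (A # As) * num k"
    using Cons by (simp add: mult.assoc)
  finally show ?case .
qed simp

text \<open>The generator moves right, grading the factors it passes, until the matrix at its own
  site absorbs it; the list of sites is unchanged.\<close>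

lemma left_mult_mon_mem:
  assumes "length js = length As" "set js \<subseteq> J" "distinct js" "k \<in> set js"
    "b = a k \<or> b = adj (a k)"
  shows "\<exists>As'. length As' = length js \<and> b * mon js As = mon js As'"
  using assms
proof (induction js As rule: list_induct2)
  case (Cons j js A As)
  have J: "j \<in> J" "k \<in> J" using Cons.prems by auto
  show ?case
  proof (cases "j = k")
    case True
    obtain B where "b = car_embed a k B"
      using Cons.prems(4) embed_units(1,2)[of k] by metis
    then have "b * mon (j # js) (A # As) = mon (j # js) ((B ** A) # As)"
      using True J embed_mult[of k B A] by (simp add: mult.assoc[symmetric])
    then show ?thesis using Cons.hyps by (intro exI[of _ "(B ** A) # As"]) simp
  next
    case False
    then obtain As' where As': "length As' = length js" "b * mon js As = mon js As'"
      using Cons.IH Cons.prems by auto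
    have "b * mon (j # js) (A # As) = (b * car_embed a j A) * mon js As"
      by (simp add: mult.assoc)
    also have "\<dots> = car_embed a j (matrix_grading A) * (b * mon js As)"
      using grading_commute[OF J False Cons.prems(4), of A] by (simp add: mult.assoc)
    finally have "b * mon (j # js) (A # As) = mon (j # js) (matrix_grading A # As')"
      by (simp add: As')
    then show ?thesis using As' by (intro exI[of _ "matrix_grading A # As'"]) simp
  qed
qed simp

section \<open>Density of the monomials\<close>

definition monomials :: "'a set" where
  "monomials = {mon js As | js As. length As = length js \<and> distinct js \<and> set js \<subseteq> J}"

lemma monI: "length As = length js \<Longrightarrow> distinct js \<Longrightarrow> set js \<subseteq> J \<Longrightarrow> mon js As \<in> monomials"
  by (auto simp: monomials_def)

lemma one_monomial: "1 \<in> monomials"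
  using monI[of "[]" "[]"] by simp

lemma left_mult_monomials:
  assumes "k \<in> J" "b = a k \<or> b = adj (a k)" "m \<in> monomials"
  shows "b * m \<in> monomials"
proof -
  obtain js As where m: "m = mon js As" "length As = length js" "distinct js" "set js \<subseteq> J"
    using assms(3) by (auto simp: monomials_def)
  show ?thesis
  proof (cases "k \<in> set js")
    case True
    then show ?thesis
      using left_mult_mon_mem[of js As k b] m assms(2) by (auto intro: monI)
  next
    case False
    obtain B where "b = car_embed a k B"
      using assms(2) embed_units(1,2)[of k] by metis
    then have "b * m = mon (k # js) (B # As)" by (simp add: m)
    then show ?thesis
      using monI[of "B # As" "k # js"] m False assms(1) by simp
  qed
qed

definition closed_subspace :: "'a set \<Rightarrow> bool" where
  "closed_subspace S \<longleftrightarrow> closed S \<and> (\<forall>x\<in>S. \<forall>y\<in>S. x + y \<in> S) \<and> (\<forall>c. \<forall>x\<in>S. c *\<^sub>C x \<in> S)"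

text \<open>The elements \<open>x\<close> for which both \<open>x\<close> and \<open>adj x\<close> map the closed span of the monomials into
  itself form a unital C*-subalgebra containing the generators.\<close>

lemma monomials_dense: "closed_subspace hull monomials = UNIV"
proof -
  define S where "S = closed_subspace hull monomials"
  have "closed_subspace S"
    unfolding S_def by (rule hull_in) (auto simp: closed_subspace_def)
  then have S: "closed S" "\<And>x y. x \<in> S \<Longrightarrow> y \<in> S \<Longrightarrow> x + y \<in> S"
      "\<And>c x. x \<in> S \<Longrightarrow> c *\<^sub>C x \<in> S"
    by (auto simp: closed_subspace_def)
  have mS: "monomials \<subseteq> S" unfolding S_def by (rule hull_subset)
  define B where "B = {x. \<forall>s\<in>S. x * s \<in> S \<and> adj x * s \<in> S}"
  have gen: "b * s \<in> S" if "k \<in> J" "b = a k \<or> b = adj (a k)" "s \<in> S" for k b s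
    using that(3) unfolding S_def
  proof (rule hull_induct)
    show "b * x \<in> closed_subspace hull monomials" if "x \<in> monomials" for x
      using left_mult_monomials[OF \<open>k \<in> J\<close> \<open>b = _ \<or> _\<close> that] mS by (auto simp: S_def)
    have "closed ((\<lambda>x. b * x) -` S)"
      by (intro continuous_closed_vimage S continuous_intros)
    then show "closed_subspace {x. b * x \<in> closed_subspace hull monomials}"
      using S unfolding closed_subspace_def S_def[symmetric]
      by (auto simp: vimage_def distrib_left mult_scaleC_right)
  qed
  have "unital_cstar_subalgebra B"
    unfolding unital_cstar_subalgebra_def
  proof (intro conjI ballI allI)
    have B: "B = (\<Inter>s\<in>S. (\<lambda>x. x * s) -` S \<inter> (\<lambda>x. adj x * s) -` S)"
      by (auto simp: B_def)
    have "closed ((\<lambda>x. adj x * s) -` S)" "closed ((\<lambda>x. x * s) -` S)" for s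
      by (intro continuous_closed_vimage S continuous_intros
          linear_continuous_at bounded_linear_adj)+
    then show "closed B" unfolding B by (intro closed_INT ballI closed_Int) auto
    show "1 \<in> B" by (simp add: B_def)
    show "x + y \<in> B" if "x \<in> B" "y \<in> B" for x y
      using that S by (auto simp: B_def adj_add distrib_right)
    show "x * y \<in> B" if "x \<in> B" "y \<in> B" for x y
      using that S by (auto simp: B_def adj_mult mult.assoc)
    show "c *\<^sub>C x \<in> B" if "x \<in> B" for c x
      using that S by (auto simp: B_def adj_scaleC mult_scaleC_left)
    show "adj x \<in> B" if "x \<in> B" for x
      using that by (auto simp: B_def adj_adj)
  qed
  moreover have "a ` J \<subseteq> B"
    using gen by (auto simp: B_def)
  ultimately have "unital_cstar_subalgebra hull (a ` J) \<subseteq> B"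
    by (intro hull_minimal)
  then have "x \<in> B" for x using car by (auto simp: CAR_def)
  then have "x * 1 \<in> S" for x using mS one_monomial unfolding B_def by blast
  then show ?thesis by (auto simp: S_def)
qed

lemma car_induct [case_names mon add scaleC closed]:
  assumes "\<And>js As. length As = length js \<Longrightarrow> distinct js \<Longrightarrow> set js \<subseteq> J \<Longrightarrow> P (mon js As)"
    and "\<And>x y. P x \<Longrightarrow> P y \<Longrightarrow> P (x + y)" and "\<And>c x. P x \<Longrightarrow> P (c *\<^sub>C x)"
    and "closed {x. P x}"
  shows "P x"
proof -
  have "x \<in> closed_subspace hull monomials" by (simp add: monomials_dense)
  then show ?thesis
    by (rule hull_induct) (use assms in \<open>auto simp: monomials_def closed_subspace_def\<close>)
qed

text \<open>Plain functions are used rather than bounded functionals as objects, so that composites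
  with automorphisms are covered as well.\<close>

lemma functional_eqI:
  assumes f: "bounded_linear f" "\<And>c x. f (c *\<^sub>C x) = c * (f x :: complex)"
    and g: "bounded_linear g" "\<And>c x. g (c *\<^sub>C x) = c * (g x :: complex)"
    and eq: "\<And>js As. length As = length js \<Longrightarrow> distinct js \<Longrightarrow> set js \<subseteq> J \<Longrightarrow>
      f (mon js As) = g (mon js As)"
  shows "f x = g x"
proof (induction x rule: car_induct)
  case closed
  show ?case
    by (intro closed_Collect_eq linear_continuous_on f g)
qed (simp_all add: eq f g linear_add bounded_linear.linear)

end

subsection \<open>Symmetric states as exchangeable states\<close>

lemma bounded_linear_automorphism:
  fixes \<alpha> :: "'a::cstar_algebra \<Rightarrow> 'a"
  assumes "cstar_automorphism \<alpha>"
  shows "bounded_linear \<alpha>"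
  using assms by (intro bounded_linear_intro[where K=1])
    (auto simp: cstar_automorphism_def scaleR_scaleC)

lemma automorphism_one:
  fixes \<alpha> :: "'a::cstar_algebra \<Rightarrow> 'a"
  assumes "cstar_automorphism \<alpha>"
  shows "\<alpha> 1 = 1"
proof -
  obtain y where y: "\<alpha> y = 1"
    using assms unfolding cstar_automorphism_def by (metis bij_pointE)
  have "\<alpha> (1 * y) = \<alpha> 1 * \<alpha> y" using assms unfolding cstar_automorphism_def by blast
  then show ?thesis by (simp add: y)
qed

lemma automorphism_id: "cstar_automorphism (id :: 'a::cstar_algebra \<Rightarrow> 'a)"
  by (simp add: cstar_automorphism_def)

lemma automorphism_comp:
  "cstar_automorphism \<alpha> \<Longrightarrow> cstar_automorphism \<beta> \<Longrightarrow> cstar_automorphism (\<alpha> \<circ> \<beta>)"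
  by (simp add: cstar_automorphism_def bij_comp)

text \<open>Conjugation by a self-adjoint unitary is an involution; it is contractive, and so is its
  inverse, hence it is isometric.\<close>

lemma automorphism_conjugation:
  fixes u :: "'a::cstar_algebra"
  assumes u: "adj u = u" "u * u = 1"
  shows "cstar_automorphism (\<lambda>x. u * x * u)"
proof -
  have uu: "u * (u * x) = x" for x using u(2) by (simp add: mult.assoc[symmetric])
  have "norm u ^ 2 = 1" using cstar_identity[of u] u by simp
  then have nu: "norm u = 1" by (intro power2_eq_imp_eq[of "norm u" 1]) auto
  have le: "norm (u * x * u) \<le> norm x" for x
    using norm_mult_ineq[of "u * x" u] norm_mult_ineq[of u x] by (simp add: nu)
  have "norm x \<le> norm (u * x * u)" for x
    using le[of "u * x * u"] by (simp add: mult.assoc uu u)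
  with le have "norm (u * x * u) = norm x" for x by (simp add: order_antisym)
  moreover have "bij (\<lambda>x. u * x * u)"
    by (rule involuntory_imp_bij) (simp add: mult.assoc uu u)
  ultimately show ?thesis
    by (simp add: cstar_automorphism_def distrib_left distrib_right mult_scaleC_left
        mult_scaleC_right adj_mult u mult.assoc uu)
qed

context car
begin

lemma automorphism_mon:
  assumes "cstar_automorphism \<alpha>" "\<And>j. j \<in> J \<Longrightarrow> \<alpha> (a j) = a (g j)"
    and "length js = length As" "set js \<subseteq> J"
  shows "\<alpha> (mon js As) = mon (map g js) As"
  using assms(3,4)
proof (induction js As rule: list_induct2)
  case Nil
  then show ?case using automorphism_one[OF assms(1)] by simp
next
  case (Cons j js A As)
  have hom: "\<alpha> (x + y) = \<alpha> x + \<alpha> y" "\<alpha> (x * y) = \<alpha> x * \<alpha> y"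
    "\<alpha> (c *\<^sub>C x) = c *\<^sub>C \<alpha> x" "\<alpha> (adj x) = adj (\<alpha> x)" for x y c
    using assms(1) by (auto simp: cstar_automorphism_def)
  show ?case using Cons by (simp add: hom car_embed_def assms(2))
qed

text \<open>Half of \<open>n\<close> is the projection belonging to the mode
  \<open>(a j - a k) / sqrt 2\<close>. The reflection \<open>u = 1 - n\<close> negates this mode and
  fixes the orthogonal one, so conjugation by it swaps \<open>a j\<close> and
  \<open>a k\<close>.\<close>

lemma transposition_automorphism:
  assumes jk: "j \<in> J" "k \<in> J" "j \<noteq> k"
  shows "\<exists>\<alpha>. cstar_automorphism \<alpha> \<and> (\<forall>l\<in>J. \<alpha> (a l) = a (Transposition.transpose j k l))"
proof -
  define v where "v = a j - a k"
  define n where "n = adj v * v"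
  define u where "u = 1 - n"
  have anti: "v * a l = - (a l * v)" if "l \<in> J" for l
  proof -
    have "a j * a l = - (a l * a j)" "a k * a l = - (a l * a k)"
      using anticomm_same(1)[of j l] anticomm_same(1)[of k l] jk that
      by (simp_all add: eq_neg_iff_add_eq_0)
    then show ?thesis by (simp add: v_def left_diff_distrib right_diff_distrib)
  qed
  have anti': "adj v * a l = (if l = j then 1 else if l = k then - 1 else 0) - a l * adj v"
    if "l \<in> J" for l
    using anticomm_adj[of j l] anticomm_adj[of k l] jk that
    by (auto simp: v_def adj_diff algebra_simps eq_diff_eq)
  have vv: "v * v = 0"
    using anti[OF jk(1)] anti[OF jk(2)] square_zero[OF jk(1)] square_zero[OF jk(2)]
      anticomm_same(1)[OF jk(1,2)] by (simp add: v_def algebra_simps)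
  have v_adj: "v * adj v = 2 - adj v * v"
    using anti'[OF jk(1)] anti'[OF jk(2)] jk by (simp add: v_def algebra_simps)
  have vn: "v * n = 2 * v"
  proof -
    have "v * n = (v * adj v) * v" by (simp add: n_def mult.assoc)
    also have "\<dots> = 2 * v" unfolding v_adj by (simp add: left_diff_distrib mult.assoc vv)
    finally show ?thesis .
  qed
  have nn: "n * n = 2 * n"
  proof -
    have "n * n = adj v * (v * n)" by (simp only: n_def mult.assoc)
    also have "\<dots> = 2 * n" unfolding vn by (simp add: n_def mult_2 distrib_left)
    finally show ?thesis .
  qed
  have adj_u: "adj u = u" by (simp add: u_def n_def adj_diff adj_mult adj_adj)
  have uu: "u * u = 1"
    by (simp add: u_def algebra_simps nn mult_2)
  \<comment> \<open>Two anticommutations cancel their signs, so the commutator of \<open>n\<close>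
    with a generator is only a multiple of \<open>v\<close>.\<close>
  have n_a: "n * a l = a l * n - (if l = j then 1 else if l = k then - 1 else 0) * v"
    if "l \<in> J" for l
  proof -
    have "n * a l = - ((adj v * a l) * v)"
      by (simp add: n_def mult.assoc anti[OF that])
    then show ?thesis unfolding anti'[OF that] by (simp add: n_def algebra_simps)
  qed
  have uj: "u * a j = a k * u"
  proof -
    have "u * a j - a k * u = 2 * v - v * n"
      by (simp add: u_def left_diff_distrib right_diff_distrib n_a[OF jk(1)])
         (simp add: v_def algebra_simps mult_2)
    then show ?thesis by (simp add: vn)
  qed
  \<comment> \<open>The previous relation is multiplied by \<open>u\<close> on both sides.\<close>
  have uk: "u * a k = a j * u"
  proof -
    have "u * (a k * u) * u = u * (u * a j) * u" using uj by simp
    moreover have "u * (a k * u) * u = u * a k" by (simp add: mult.assoc uu)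
    moreover have "u * (u * a j) * u = a j * u"
      by (simp add: mult.assoc[symmetric] uu)
    ultimately show ?thesis by simp
  qed
  have ul: "u * a l = a l * u" if "l \<in> J" "l \<noteq> j" "l \<noteq> k" for l
    using n_a[OF that(1)] that by (simp add: u_def algebra_simps)
  have "u * a l * u = a (Transposition.transpose j k l)" if "l \<in> J" for l
    using uj uk ul[OF that] by (cases "l = j"; cases "l = k") (auto simp: mult.assoc uu)
  then show ?thesis using automorphism_conjugation[OF adj_u uu] by blast
qed

text \<open>A permutation of finite support is a product of transpositions, and the automorphisms of
  these compose.\<close>

lemma permutation_automorphism_ex:
  assumes "g \<in> finitary_permutations J"
  shows "\<exists>\<alpha>. cstar_automorphism \<alpha> \<and> (\<forall>j\<in>J. \<alpha> (a j) = a (g j))"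
proof -
  define S where "S = {j. g j \<noteq> j}"
  have g: "g permutes J" "finite S" using assms by (auto simp: finitary_permutations_def S_def)
  have "S \<subseteq> J" using g by (auto simp: S_def permutes_def)
  have "g permutes S" using g(1) by (auto simp: permutes_def S_def)
  then show ?thesis using \<open>finite S\<close>
  proof (induction rule: permutes_induct)
    case id
    have "\<forall>j\<in>J. id (a j) = a (id j)" by simp
    with automorphism_id show ?case by blast
  next
    case (swap j k p)
    obtain \<alpha> where \<alpha>: "cstar_automorphism \<alpha>" "\<forall>j\<in>J. \<alpha> (a j) = a (p j)"
      using swap.IH by blast
    obtain \<beta> where \<beta>: "cstar_automorphism \<beta>"
      "\<forall>l\<in>J. \<beta> (a l) = a (Transposition.transpose j k l)"
      using transposition_automorphism[of j k] swap.hyps \<open>S \<subseteq> J\<close> by blast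
    have "p l \<in> J" if "l \<in> J" for l
      using permutes_in_image[OF permutes_subset[OF swap.hyps(4) \<open>S \<subseteq> J\<close>]] that by simp
    with \<alpha> \<beta> have "\<forall>l\<in>J. (\<beta> \<circ> \<alpha>) (a l) = a ((Transposition.transpose j k \<circ> p) l)" by simp
    with automorphism_comp[OF \<beta>(1) \<alpha>(1)] show ?case by blast
  qed
qed

lemma automorphism_unique:
  assumes "cstar_automorphism \<alpha>" "cstar_automorphism \<beta>" "\<And>j. j \<in> J \<Longrightarrow> \<alpha> (a j) = \<beta> (a j)"
  shows "\<alpha> = \<beta>"
proof
  have hom: "\<gamma> (x + y) = \<gamma> x + \<gamma> y" "\<gamma> (x * y) = \<gamma> x * \<gamma> y"
    "\<gamma> (c *\<^sub>C x) = c *\<^sub>C \<gamma> x" "\<gamma> (adj x) = adj (\<gamma> x)"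
    if "cstar_automorphism \<gamma>" for x y c and \<gamma> :: "'a \<Rightarrow> 'a"
    using that by (auto simp: cstar_automorphism_def)
  show "\<alpha> x = \<beta> x" for x
  proof (induction x rule: car_induct)
    case (mon js As)
    then have "length js = length As" "set js \<subseteq> J" by simp_all
    then show ?case
      by (induction js As rule: list_induct2)
         (simp_all add: automorphism_one assms car_embed_def hom[OF assms(1)] hom[OF assms(2)])
  next
    case closed
    show ?case
      by (intro closed_Collect_eq linear_continuous_on bounded_linear_automorphism assms)
  qed (simp_all add: hom[OF assms(1)] hom[OF assms(2)])
qed

text \<open>Existence and uniqueness together show that the definite description in
  \<open>car_perm\<close> denotes.\<close>

lemma car_perm:
  assumes "g \<in> finitary_permutations J"
  shows "cstar_automorphism (car_perm J a g)" "j \<in> J \<Longrightarrow> car_perm J a g (a j) = a (g j)"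
proof -
  have "\<exists>!\<alpha>. cstar_automorphism \<alpha> \<and> (\<forall>j\<in>J. \<alpha> (a j) = a (g j))"
  proof -
    obtain \<alpha> where "cstar_automorphism \<alpha> \<and> (\<forall>j\<in>J. \<alpha> (a j) = a (g j))"
      using permutation_automorphism_ex[OF assms] by blast
    then show ?thesis by (intro ex1I[of _ \<alpha>] automorphism_unique) auto
  qed
  from theI'[OF this] show "cstar_automorphism (car_perm J a g)"
    "j \<in> J \<Longrightarrow> car_perm J a g (a j) = a (g j)"
    unfolding car_perm_def by blast+
qed

text \<open>Symmetry is expressed by values on monomials alone, without automorphisms; in this form
  it is easy to check for limits of cut-down functionals.\<close>

definition exchangeable :: "('a \<Rightarrow>\<^sub>L complex) \<Rightarrow> bool" where
  "exchangeable f \<longleftrightarrow> (\<forall>js js' As. distinct js \<and> distinct js' \<and> set js \<subseteq> J \<and> set js' \<subseteq> J \<and>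
     length js = length As \<and> length js' = length As \<longrightarrow> f (mon js As) = f (mon js' As))"

lemma exchangeableD:
  "exchangeable f \<Longrightarrow> distinct js \<Longrightarrow> distinct js' \<Longrightarrow> set js \<subseteq> J \<Longrightarrow> set js' \<subseteq> J \<Longrightarrow>
     length js = length As \<Longrightarrow> length js' = length As \<Longrightarrow> f (mon js As) = f (mon js' As)"
  unfolding exchangeable_def by blast

lemma fresh_list:
  assumes "finite F"
  obtains ks where "distinct ks" "length ks = n" "set ks \<subseteq> J" "set ks \<inter> F = {}"
proof -
  have "infinite (J - F)" using infinite_J assms by (rule Diff_infinite_finite[rotated])
  then obtain B where "finite B" "card B = n" "B \<subseteq> J - F"
    using infinite_arbitrarily_large by blast
  moreover then obtain ks where "set ks = B" "distinct ks" using finite_distinct_list by blast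
  ultimately show ?thesis using that[of ks] distinct_card[of ks] by auto
qed

text \<open>The sites are exchanged one at a time. Since the two lists are disjoint, each
  transposition leaves the sites already replaced, collected in \<open>xs\<close>, and those still
  waiting untouched.\<close>

lemma symmetric_states_replace:
  assumes f: "f \<in> symmetric_states J a"
    and "length js = length js'"
    and "distinct (xs @ js)" "distinct (xs @ js')" "set js \<inter> set js' = {}"
    and "set (xs @ js) \<subseteq> J" "set (xs @ js') \<subseteq> J" "length As = length (xs @ js)"
  shows "f (mon (xs @ js) As) = f (mon (xs @ js') As)"
  using assms(2-)
proof (induction js js' arbitrary: xs rule: list_induct2)
  case (Cons j js j' js')
  let ?t = "Transposition.transpose j j'"
  have jj: "j \<in> J" "j' \<in> J" using Cons.prems by auto
  have "{l. ?t l \<noteq> l} \<subseteq> {j, j'}" by (auto simp: Transposition.transpose_def)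
  then have t: "?t \<in> finitary_permutations J"
    using jj permutes_swap_id[of j J j']
    by (auto simp: finitary_permutations_def intro: finite_subset)
  have "map ?t xs = xs" "map ?t js = js"
    using Cons.prems by (auto simp: Transposition.transpose_def intro!: map_idI)
  then have map: "map ?t (xs @ j # js) = (xs @ [j']) @ js" by simp
  have "blinfun_apply f \<circ> car_perm J a ?t = blinfun_apply f"
    using f t by (simp add: symmetric_states_def)
  then have "f (mon (xs @ j # js) As) = f (car_perm J a ?t (mon (xs @ j # js) As))"
    by (metis comp_apply)
  also have "car_perm J a ?t (mon (xs @ j # js) As) = mon ((xs @ [j']) @ js) As"
    unfolding map[symmetric] using Cons.prems by (intro automorphism_mon car_perm t) auto
  also have "f \<dots> = f (mon ((xs @ [j']) @ js') As)"
    using Cons.prems by (intro Cons.IH) auto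
  finally show ?case by simp
qed simp

lemma symmetric_states_iff: "f \<in> symmetric_states J a \<longleftrightarrow> f \<in> states \<and> exchangeable f"
proof (intro iffI conjI)
  assume f: "f \<in> symmetric_states J a"
  then show "f \<in> states" by (simp add: symmetric_states_def)
  show "exchangeable f"
    unfolding exchangeable_def
  proof (intro allI impI, elim conjE)
    fix js js' :: "'j list" and As :: "(complex^2^2) list"
    assume *: "distinct js" "distinct js'" "set js \<subseteq> J" "set js' \<subseteq> J"
      "length js = length As" "length js' = length As"
    \<comment> \<open>The lists \<open>js\<close> and \<open>js'\<close> may overlap, so both are
      compared with a third list disjoint from them.\<close>
    obtain ks where ks: "distinct ks" "length ks = length As" "set ks \<subseteq> J"
      "set ks \<inter> (set js \<union> set js') = {}" by (rule fresh_list[of "set js \<union> set js'"]) auto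
    have "f (mon ([] @ is) As) = f (mon ([] @ ks) As)" if "is = js \<or> is = js'" for "is"
      by (intro symmetric_states_replace[OF f]) (use * ks that in auto)
    then have "f (mon js As) = f (mon ks As)" "f (mon js' As) = f (mon ks As)" by simp_all
    then show "f (mon js As) = f (mon js' As)" by simp
  qed
next
  assume f: "f \<in> states \<and> exchangeable f"
  \<comment> \<open>A permutation carries distinct sites to distinct sites, so both functionals
    agree on monomials, and density does the rest.\<close>
  have "f (car_perm J a g x) = f x" if g: "g \<in> finitary_permutations J" for g x
  proof (rule functional_eqI)
    note \<alpha> = car_perm[OF g]
    show "bounded_linear (\<lambda>x. f (car_perm J a g x))"
      by (rule bounded_linear_compose[OF blinfun.bounded_linear_right
          bounded_linear_automorphism[OF \<alpha>(1)]])
    show "f (car_perm J a g (c *\<^sub>C x)) = c * f (car_perm J a g x)" for c x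
      using f \<alpha>(1) by (auto simp: states_def cstar_automorphism_def)
    show "bounded_linear f" by (rule blinfun.bounded_linear_right)
    show "f (c *\<^sub>C x) = c * f x" for c x using f by (auto simp: states_def)
    show "f (car_perm J a g (mon js As)) = f (mon js As)"
      if "length As = length js" "distinct js" "set js \<subseteq> J" for js As
    proof -
      have gp: "g permutes J" using g by (simp add: finitary_permutations_def)
      have "car_perm J a g (mon js As) = mon (map g js) As"
        using that by (intro automorphism_mon \<alpha>) auto
      moreover have "f (mon (map g js) As) = f (mon js As)"
        using that f permutes_in_image[OF gp] permutes_inj_on[OF gp]
        by (intro exchangeableD) (auto simp: distinct_map)
      ultimately show ?thesis by simp
    qed
  qed
  then show "f \<in> symmetric_states J a"
    using f by (auto simp: symmetric_states_def)
qed

end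

subsection \<open>Product states are extreme\<close>

context car
begin

lemma adj_mon:
  assumes "length js = length As"
  shows "adj (mon js As) = mon (rev js) (map matrix_adj (rev As))"
  using assms
  by (induction js As rule: list_induct2) (simp_all add: adj_mult embed_adj mon_append)

lemma norm_mon_le:
  assumes "length js = length As" "set js \<subseteq> J"
  shows "norm (mon js As)
    \<le> prod_list (map (\<lambda>A. cmod (A$1$1) + cmod (A$1$2) + cmod (A$2$1) + cmod (A$2$2)) As)"
  using assms
proof (induction js As rule: list_induct2)
  case (Cons j js A As)
  have "norm (mon (j # js) (A # As)) \<le> norm (car_embed a j A) * norm (mon js As)"
    by (simp add: norm_mult_ineq)
  also have "\<dots> \<le> prod_list (map (\<lambda>A. cmod (A$1$1) + cmod (A$1$2) + cmod (A$2$1) + cmod (A$2$2)) (A # As))"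
    using Cons by (auto intro!: mult_mono norm_embed_le)
  finally show ?case .
qed simp

text \<open>An injective sequence in \<open>J\<close> is split into blocks by the pairing function;
  injectivity of the pairing makes the blocks disjoint.\<close>

lemma disjoint_copies:
  obtains ks where "\<And>i. distinct (ks i)" "\<And>i. length (ks i) = n" "\<And>i. set (ks i) \<subseteq> J"
    "\<And>i j :: nat. i \<noteq> j \<Longrightarrow> set (ks i) \<inter> set (ks j) = {}"
proof -
  obtain e :: "nat \<Rightarrow> 'j" where e: "inj e" "range e \<subseteq> J"
    using infinite_countable_subset[OF infinite_J] by blast
  show ?thesis
  proof (rule that[of "\<lambda>i. map (\<lambda>l. e (prod_encode (i, l))) [0..<n]"])
    show "distinct (map (\<lambda>l. e (prod_encode (i, l))) [0..<n])" for i
      by (auto simp: distinct_map inj_on_def inj_eq[OF e(1)])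
    show "set (map (\<lambda>l. e (prod_encode (i, l))) [0..<n])
        \<inter> set (map (\<lambda>l. e (prod_encode (j, l))) [0..<n]) = {}" if "i \<noteq> j" for i j
      using that by (auto simp: inj_eq[OF e(1)])
  qed (use e in auto)
qed

text \<open>Under \<open>f\<close> the centred copies \<open>z i\<close> are uncorrelated, so the
  second moment of a sum of \<open>n\<close> of them is linear in \<open>n\<close>. Domination
  transfers this to \<open>g\<close>, and \<open>averaging\<close> with \<open>w = 1\<close> gives
  equal values on monomials.\<close>

lemma product_state_dominating:
  assumes f: "is_product_state J a \<rho> f" and g: "g \<in> symmetric_states J a"
    and dom: "\<And>x. Re (g (adj x * x)) \<le> K * Re (f (adj x * x))" and K: "K \<ge> 0"
  shows "g = f"
proof (rule blinfun_eqI, rule functional_eqI)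
  have f_states: "f \<in> states" using f by (simp add: is_product_state_def)
  have fpos: "positive_functional f" and f1: "f 1 = 1" using f_states by (auto simp: states_eq)
  have gpos: "positive_functional g" and g1: "g 1 = 1" and gex: "exchangeable g"
    using g by (auto simp: symmetric_states_iff states_eq)
  note fC = positive_functional_scaleC[OF fpos] and gC = positive_functional_scaleC[OF gpos]
  have f_mon: "f (mon js As) = prod_list (map \<rho> As)"
    if "distinct js" "set js \<subseteq> J" "length js = length As" for js As
    using f that by (simp add: is_product_state_def mon_def)
  fix js :: "'j list" and As :: "(complex^2^2) list"
  assume js: "length As = length js" "distinct js" "set js \<subseteq> J"
  obtain ks where ks: "\<And>i. distinct (ks i)" "\<And>i. length (ks i) = length As" "\<And>i. set (ks i) \<subseteq> J"
    "\<And>i j :: nat. i \<noteq> j \<Longrightarrow> set (ks i) \<inter> set (ks j) = {}"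
    by (rule disjoint_copies[of "length As"]) (rule that)
  define c c' where "c = prod_list (map \<rho> As)" and "c' = prod_list (map \<rho> (map matrix_adj (rev As)))"
  define m where "m i = mon (ks i) As" for i
  define z where "z i = m i - c *\<^sub>C 1" for i
  have adj_m: "adj (m i) = mon (rev (ks i)) (map matrix_adj (rev As))" for i
    by (simp add: m_def adj_mon ks)
  have fm: "f (m i) = c" "f (adj (m i)) = c'" for i
    unfolding adj_m unfolding m_def c_def c'_def by (intro f_mon; simp add: ks)+
  have fmm: "f (adj (m i) * m j) = c' * c" if "i \<noteq> j" for i j
  proof -
    have "adj (m i) * m j = mon (rev (ks i) @ ks j) (map matrix_adj (rev As) @ As)"
      unfolding adj_m by (simp add: m_def mon_append ks)
    also have "f \<dots> = c' * c"
      by (subst f_mon) (use ks ks(4)[OF that] in \<open>simp_all add: c_def c'_def\<close>)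
    finally show ?thesis .
  qed
  \<comment> \<open>After expansion the four values \<open>c' * c\<close>, \<open>- c * c'\<close>,
    \<open>- cnj c * c\<close> and \<open>cnj c * c\<close> cancel in pairs.\<close>
  have orth: "f (adj (z i) * z j) = 0" if "i \<noteq> j" for i j
  proof -
    have "adj (z i) * z j = adj (m i) * m j - c *\<^sub>C adj (m i) - cnj c *\<^sub>C m j + (cnj c * c) *\<^sub>C 1"
      by (simp add: z_def adj_diff adj_scaleC algebra_simps mult_scaleC_left mult_scaleC_right
          scaleC_scaleC scaleC_diff_right)
    then show ?thesis
      by (simp add: blinfun.diff_right blinfun.add_right fC fm fmm[OF that] f1)
  qed
  \<comment> \<open>All copies carry the same matrices, so one bound serves every index.\<close>
  define M where "M = prod_list (map (\<lambda>A. cmod (A$1$1) + cmod (A$1$2) + cmod (A$2$1) + cmod (A$2$2)) As)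
      + cmod c"
  have norm_z: "norm (z i) \<le> M" for i
    unfolding z_def m_def M_def
    by (intro norm_triangle_le_diff add_mono norm_mon_le) (simp_all add: ks norm_scaleC)
  define C where "C = norm f * M\<^sup>2"
  have diag: "Re (f (adj (z i) * z i)) \<le> C" for i
  proof -
    have "Re (f (adj (z i) * z i)) \<le> norm (f (adj (z i) * z i))" by (rule complex_Re_le_cmod)
    also have "\<dots> \<le> norm f * (norm (z i))\<^sup>2"
      using norm_blinfun[of f "adj (z i) * z i"] by (simp add: cstar_identity)
    also have "\<dots> \<le> C"
      unfolding C_def by (intro mult_left_mono power_mono norm_z) auto
    finally show ?thesis .
  qed
  have bound: "Re (f (adj (\<Sum>i<n. z i) * (\<Sum>i<n. z i))) \<le> C * n" for n
  proof -
    have "f (adj (\<Sum>i<n. z i) * (\<Sum>i<n. z i)) = (\<Sum>i<n. \<Sum>j<n. f (adj (z i) * z j))"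
      by (simp add: adj_sum sum_product blinfun.sum_right)
    also have "\<dots> = (\<Sum>i<n. \<Sum>j<n. if i = j then f (adj (z i) * z i) else 0)"
      by (intro sum.cong) (auto simp: orth)
    also have "\<dots> = (\<Sum>i<n. f (adj (z i) * z i))" by simp
    finally show ?thesis
      using sum_mono[of "{..<n}" "\<lambda>i. Re (f (adj (z i) * z i))" "\<lambda>_. C"] diag
      by (simp add: mult.commute)
  qed
  have gm: "g (m i) = g (mon js As)" for i
    unfolding m_def using ks js by (intro exchangeableD[OF gex]) auto
  have "g (mon js As) - c = 0"
  proof (rule averaging[where w = 1, OF gpos dom K bound])
    show "g (adj 1 * z i) = g (mon js As) - c" for i
      by (simp add: z_def blinfun.diff_right gC g1 gm)
  qed
  then show "g (mon js As) = f (mon js As)"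
    using f_mon[of js As] js by (simp add: c_def)
qed (use f g in \<open>auto simp: is_product_state_def symmetric_states_def states_def
    intro: blinfun.bounded_linear_right\<close>)

text \<open>In a proper convex decomposition of \<open>f\<close> each component is dominated by a
  multiple of \<open>f\<close>, hence equals \<open>f\<close>.\<close>

lemma product_state_extreme:
  assumes f: "is_product_state J a \<rho> f" and sym: "f \<in> symmetric_states J a"
  shows "f extreme_point_of symmetric_states J a"
  unfolding extreme_point_of_def
proof (intro conjI ballI notI sym)
  fix g h assume gh: "g \<in> symmetric_states J a" "h \<in> symmetric_states J a" "f \<in> open_segment g h"
  then obtain u where u: "g \<noteq> h" "0 < u" "u < 1" "f = (1 - u) *\<^sub>R g + u *\<^sub>R h"
    by (auto simp: in_segment)
  have pos: "positive_functional g" "positive_functional h"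
    using gh by (auto simp: symmetric_states_iff states_eq)
  have Re_f: "Re (f x) = (1 - u) * Re (g x) + u * Re (h x)" for x
    by (simp add: u(4) blinfun.add_left blinfun.scaleR_left)
  have "g = f"
  proof (rule product_state_dominating[OF f gh(1), where K = "1 / (1 - u)"])
    show "Re (g (adj x * x)) \<le> 1 / (1 - u) * Re (f (adj x * x))" for x
      unfolding Re_f using u positive_functional_Re_nonneg[OF pos(2), of x]
      by (simp add: field_simps)
  qed (use u in auto)
  moreover have "h = f"
  proof (rule product_state_dominating[OF f gh(2), where K = "1 / u"])
    show "Re (h (adj x * x)) \<le> 1 / u * Re (f (adj x * x))" for x
      unfolding Re_f using u positive_functional_Re_nonneg[OF pos(1), of x]
      by (simp add: field_simps mult_left_le_one_le)
  qed (use u in auto)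
  ultimately show False using u(1) by simp
qed

end

subsection \<open>Extreme symmetric states are product states\<close>

text \<open>The uniform bound permits the usual \<open>e / 3\<close> argument: an approximating
  point makes the sequence of values at the limit Cauchy.\<close>

lemma closed_convergent:
  fixes T :: "nat \<Rightarrow> 'a::real_normed_vector \<Rightarrow> 'b::banach"
  assumes lin: "\<And>n. bounded_linear (T n)" and bound: "\<And>n x. norm (T n x) \<le> K * norm x"
  shows "closed {x. convergent (\<lambda>n. T n x)}"
  unfolding closed_sequential_limits
proof (intro allI impI, elim conjE)
  fix xs l assume xs: "\<forall>m. xs m \<in> {x. convergent (\<lambda>n. T n x)}" and l: "xs \<longlonglongrightarrow> l"
  have "Cauchy (\<lambda>n. T n l)"
  proof (rule metric_CauchyI)
    fix e :: real assume "e > 0"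
    have "(\<lambda>m. \<bar>K\<bar> * norm (l - xs m)) \<longlonglongrightarrow> \<bar>K\<bar> * norm (l - l)"
      by (intro tendsto_intros l)
    then have "eventually (\<lambda>m. \<bar>K\<bar> * norm (l - xs m) < e / 3) sequentially"
      using \<open>e > 0\<close> by (intro order_tendstoD(2)) auto
    then obtain m where m: "\<bar>K\<bar> * norm (l - xs m) < e / 3"
      by (auto simp: eventually_sequentially)
    have near: "dist (T n l) (T n (xs m)) < e / 3" for n
    proof -
      have "dist (T n l) (T n (xs m)) = norm (T n (l - xs m))"
        by (simp add: dist_norm linear_diff bounded_linear.linear lin)
      also have "\<dots> \<le> \<bar>K\<bar> * norm (l - xs m)"
        by (rule order_trans[OF bound]) (simp add: mult_right_mono)
      finally show ?thesis using m by simp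
    qed
    have "Cauchy (\<lambda>n. T n (xs m))" using xs by (simp add: convergent_Cauchy)
    then obtain M where M: "dist (T i (xs m)) (T j (xs m)) < e / 3" if "i \<ge> M" "j \<ge> M" for i j
      using \<open>e > 0\<close> unfolding Cauchy_def by (metis divide_pos_pos zero_less_numeral)
    have "dist (T i l) (T j l) < e" if "i \<ge> M" "j \<ge> M" for i j
      using near[of i] near[of j] M[OF that]
        dist_triangle[of "T i l" "T j l" "T i (xs m)"]
        dist_triangle[of "T i (xs m)" "T j l" "T j (xs m)"]
      by (simp add: dist_commute)
    then show "\<exists>M. \<forall>i\<ge>M. \<forall>j\<ge>M. dist (T i l) (T j l) < e" by blast
  qed
  then show "l \<in> {x. convergent (\<lambda>n. T n x)}" by (simp add: Cauchy_convergent)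
qed

context car
begin

lemma exchangeable_mult_embed:
  assumes f: "exchangeable f"
    and "distinct js" "set js \<subseteq> J" "length js = length As" "k \<in> J" "k \<notin> set js"
    and "distinct js'" "set js' \<subseteq> J" "length js' = length As" "k' \<in> J" "k' \<notin> set js'"
  shows "f (mon js As * car_embed a k A) = f (mon js' As * car_embed a k' A)"
proof -
  have "f (mon (js @ [k]) (As @ [A])) = f (mon (js' @ [k']) (As @ [A]))"
    using assms by (intro exchangeableD[OF f]) auto
  then show ?thesis using assms by (simp add: mon_append)
qed

section \<open>Vanishing of odd factors\<close>

text \<open>For the sum \<open>S\<close> of \<open>n\<close> copies, the anticommutation relations
  give \<open>adj S * S + S * adj S = n\<close>; positivity of the second term bounds the second
  moment by \<open>n\<close>.\<close>

lemma odd_factor_vanishes: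
  assumes f: "positive_functional f" "f 1 = 1" and ex: "exchangeable f"
    and js: "distinct js" "set js \<subseteq> J" "length js = length As"
    and k: "k \<in> J" "k \<notin> set js"
    and A: "A = vector [vector [0, 1], vector [0, 0]] \<or> A = vector [vector [0, 0], vector [1, 0]]"
  shows "f (mon js As * car_embed a k A) = 0"
proof -
  have "infinite (J - set js)" using infinite_J by simp
  then obtain e :: "nat \<Rightarrow> 'j" where e: "inj e" "range e \<subseteq> J - set js"
    using infinite_countable_subset by blast
  define z where "z i = car_embed a (e i) A" for i
  have z: "z = (\<lambda>i. a (e i)) \<or> z = (\<lambda>i. adj (a (e i)))"
    using A embed_units(1,2) by (auto simp: z_def)
  have eJ: "e i \<in> J" for i using e(2) by auto
  have anti: "adj (z i) * z j + z j * adj (z i) = (if i = j then 1 else 0)" for i j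
    using z anticomm_adj[OF eJ eJ, of i j] anticomm_adj[OF eJ eJ, of j i] inj_eq[OF e(1)]
    by (auto simp: adj_adj add.commute)
  have bound: "Re (f (adj (\<Sum>i<n. z i) * (\<Sum>i<n. z i))) \<le> 1 * real n" for n
  proof -
    let ?S = "\<Sum>i<n. z i"
    have "adj ?S * ?S + ?S * adj ?S = (\<Sum>i<n. \<Sum>j<n. adj (z i) * z j + z j * adj (z i))"
      unfolding adj_sum sum_product sum.distrib
      by (subst (2) sum.swap) simp
    also have "\<dots> = of_nat n" by (simp add: anti)
    finally have "f (adj ?S * ?S) + f (?S * adj ?S) = f (of_nat n)"
      by (simp add: blinfun.add_right[symmetric])
    also have "of_nat n = complex_of_real n *\<^sub>C (1::'a)"
      unfolding scaleR_scaleC[symmetric] by (simp add: scaleR_conv_of_real)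
    finally have "Re (f (adj ?S * ?S)) + Re (f (?S * adj ?S)) = n"
      using f(2) by (simp add: positive_functional_scaleC[OF f(1)] complex_eq_iff)
    then show ?thesis
      using positive_functional_Re_nonneg[OF f(1), of "adj ?S"] by (simp add: adj_adj)
  qed
  show ?thesis
  \<comment> \<open>Taking the adjoint as \<open>w\<close> makes \<open>adj w\<close> the monomial
    itself; the state dominates itself with \<open>K = 1\<close>.\<close>
  proof (rule averaging[where f = f and g = f and K = 1 and w = "adj (mon js As)", OF f(1) _ _ bound])
    show "f (adj (adj (mon js As)) * z i) = f (mon js As * car_embed a k A)" for i
      unfolding adj_adj z_def using e js k by (intro exchangeable_mult_embed[OF ex]) auto
  qed auto
qed

corollary generator_factor_vanishes:
  assumes f: "positive_functional f" "f 1 = 1" "exchangeable f"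
    and js: "distinct js" "set js \<subseteq> J" "length js = length As"
    and k: "k \<in> J" "k \<notin> set js"
  shows "f (mon js As * a k) = 0" "f (mon js As * adj (a k)) = 0"
  using odd_factor_vanishes[OF f js k disjI1[OF refl]] odd_factor_vanishes[OF f js k disjI2[OF refl]]
  by (simp_all add: embed_units)

section \<open>Cutting down by diagonal projections\<close>

text \<open>The two diagonal units are the complementary projections \<open>num k\<close> and
  \<open>1 - num k\<close>, so commutation is needed for \<open>num k\<close> only.\<close>

lemma diagonal_unit:
  assumes D: "D = vector [vector [0, 0], vector [0, 1]] \<or> D = vector [vector [1, 0], vector [0, 0]]"
    and k: "k \<in> J"
  shows "adj (car_embed a k D) = car_embed a k D"
    and "car_embed a k D * car_embed a k D = car_embed a k D"
    and "length js = length As \<Longrightarrow> set js \<subseteq> J \<Longrightarrow> k \<notin> set js \<Longrightarrow>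
      car_embed a k D * mon js As = mon js As * car_embed a k D"
proof -
  show "adj (car_embed a k D) = car_embed a k D"
    using D by (auto simp: embed_units adj_mult adj_adj)
  show "car_embed a k D * car_embed a k D = car_embed a k D"
    using D k by (auto simp: embed_units mult.assoc)
  assume "length js = length As" "set js \<subseteq> J" "k \<notin> set js"
  note c = num_commute_mon[OF this(1,2) k this(3)]
  have "a k * adj (a k) = 1 - num k"
    using anticomm_adj[OF k k] by (simp add: eq_diff_eq add.commute)
  then show "car_embed a k D * mon js As = mon js As * car_embed a k D"
    using D c by (auto simp: embed_units left_diff_distrib right_diff_distrib)
qed

text \<open>The functional is the limit of \<open>x \<mapsto> f (d\<^sub>n x d\<^sub>n)\<close> for the copies
  \<open>d\<^sub>n\<close> of the projection \<open>D\<close> at infinitely many sites. The two-sided cut-down makes positivity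
  evident; on a monomial the sequence is eventually constant.\<close>

lemma cut_down_functional:
  assumes f: "positive_functional f" and ex: "exchangeable f"
    and D: "D = vector [vector [0, 0], vector [0, 1]] \<or> D = vector [vector [1, 0], vector [0, 0]]"
  obtains \<psi> where "positive_functional \<psi>" "exchangeable \<psi>"
    "\<And>js As k. length As = length js \<Longrightarrow> distinct js \<Longrightarrow> set js \<subseteq> J \<Longrightarrow> k \<in> J \<Longrightarrow>
      k \<notin> set js \<Longrightarrow> \<psi> (mon js As) = f (mon js As * car_embed a k D)"
proof -
  obtain e :: "nat \<Rightarrow> 'j" where e: "inj e" "range e \<subseteq> J"
    using infinite_countable_subset[OF infinite_J] by blast
  then have eJ: "e n \<in> J" for n by auto
  define d where "d n = car_embed a (e n) D" for n
  have d: "adj (d n) = d n" "d n * d n = d n" for n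
    unfolding d_def by (intro diagonal_unit[OF D eJ])+
  have norm_d: "norm (d n) \<le> 1" for n by (rule norm_projection_le_1[OF d])
  define T where "T n x = f (d n * x * d n)" for n x
  have T_bound: "norm (T n x) \<le> norm f * norm x" for n x
  proof -
    have "norm (d n * x * d n) \<le> norm (d n) * norm x * norm (d n)"
      by (intro order_trans[OF norm_mult_ineq] mult_right_mono) (auto simp: norm_mult_ineq)
    also have "\<dots> \<le> 1 * norm x * 1"
      by (intro mult_mono norm_d) auto
    finally have "norm f * norm (d n * x * d n) \<le> norm f * norm x"
      by (simp add: mult_left_mono)
    then show ?thesis unfolding T_def using norm_blinfun[of f] order_trans by blast
  qed
  have T_add: "T n (x + y) = T n x + T n y" for n x y
    by (simp add: T_def distrib_left distrib_right blinfun.add_right)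
  have T_scaleC: "T n (c *\<^sub>C x) = c * T n x" for n c x
    by (simp add: T_def mult_scaleC_left mult_scaleC_right positive_functional_scaleC[OF f])
  have T_scaleR: "T n (r *\<^sub>R x) = r *\<^sub>R T n x" for n r x
    by (simp add: T_def blinfun.scaleR_right)
  have T_lin: "bounded_linear (T n)" for n
    using T_bound
    by (intro bounded_linear_intro[where K = "norm f"]) (auto simp: T_add T_scaleR mult.commute)
  have T_mon: "(\<lambda>n. T n (mon js As)) \<longlonglongrightarrow> f (mon js As * car_embed a k D)"
    if "length As = length js" "distinct js" "set js \<subseteq> J" "k \<in> J" "k \<notin> set js" for js As k
  proof (rule tendsto_eventually)
    \<comment> \<open>Only finitely many copies of the projection sit at sites of the monomial; all
      later ones commute with it and, by exchangeability, give the same value.\<close>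
    have "finite (e -` set js)" using e(1) by (simp add: finite_vimageI)
    then have "eventually (\<lambda>n. n \<notin> e -` set js) sequentially"
      by (simp add: cofinite_eq_sequentially[symmetric] eventually_cofinite vimage_def)
    then show "eventually (\<lambda>n. T n (mon js As) = f (mon js As * car_embed a k D)) sequentially"
    proof eventually_elim
      case (elim n)
      have "d n * mon js As * d n = mon js As * (d n * d n)"
        unfolding mult.assoc[symmetric] unfolding d_def
        using that elim by (subst diagonal_unit(3)[OF D eJ]) auto
      then have "T n (mon js As) = f (mon js As * car_embed a (e n) D)"
        by (simp add: T_def d d_def[symmetric])
      also have "\<dots> = f (mon js As * car_embed a k D)"
        using that elim eJ by (intro exchangeable_mult_embed[OF ex]) auto
      finally show ?case .
    qed
  qed
  \<comment> \<open>Convergence passes from monomials to all elements because the \<open>T n\<close>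
    are uniformly bounded.\<close>
  have T_convergent: "convergent (\<lambda>n. T n x)" for x
  proof (induction x rule: car_induct)
    case (mon js As)
    obtain k where "k \<in> J" "k \<notin> set js"
      using infinite_J by (meson finite_set infinite_super subsetI)
    then show ?case using T_mon mon by (auto simp: convergent_def)
  next
    case (add x y)
    then show ?case by (simp add: T_add convergent_add)
  next
    case (scaleC c x)
    then show ?case by (auto simp: T_scaleC convergent_def intro: tendsto_mult_left)
  next
    case closed
    show ?case by (rule closed_convergent[OF T_lin T_bound])
  qed
  define L where "L x = lim (\<lambda>n. T n x)" for x
  have L: "(\<lambda>n. T n x) \<longlonglongrightarrow> L x" for x
    unfolding L_def using T_convergent by (simp add: convergent_LIMSEQ_iff)
  have "bounded_linear L"
  proof (rule bounded_linear_intro[where K = "norm f"])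
    show "L (x + y) = L x + L y" for x y
      using tendsto_add[OF L L, of x y] L[of "x + y"] by (simp add: T_add LIMSEQ_unique)
    show "L (r *\<^sub>R x) = r *\<^sub>R L x" for r x
      using tendsto_scaleR[OF tendsto_const L, of r x] L[of "r *\<^sub>R x"]
      unfolding T_scaleR by (rule LIMSEQ_unique[rotated])
    show "norm (L x) \<le> norm x * norm f" for x
      by (rule Lim_bounded[OF tendsto_norm[OF L], of 0])
         (use T_bound in \<open>simp add: mult.commute\<close>)
  qed
  then have \<psi>: "blinfun_apply (Blinfun L) x = L x" for x
    by (simp add: bounded_linear_Blinfun_apply)
  have \<psi>_mon: "Blinfun L (mon js As) = f (mon js As * car_embed a k D)"
    if "length As = length js" "distinct js" "set js \<subseteq> J" "k \<in> J" "k \<notin> set js" for js As k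
    unfolding \<psi> using L T_mon[OF that] by (rule LIMSEQ_unique)
  show ?thesis
  proof (rule that[OF _ _ \<psi>_mon])
    show "positive_functional (Blinfun L)"
      unfolding positive_functional_def \<psi>
    proof (intro conjI allI)
      show "L (c *\<^sub>C x) = c * L x" for c x
        using tendsto_mult_left[OF L, of c x] L[of "c *\<^sub>C x"] unfolding T_scaleC
        by (rule LIMSEQ_unique[rotated])
      show "L (adj x * x) \<in> \<real>\<^sub>\<ge>\<^sub>0" for x
      proof (rule closed_sequentially[OF closed_nonneg_Reals_complex _ L])
        show "T n (adj x * x) \<in> \<real>\<^sub>\<ge>\<^sub>0" for n
        proof -
          have "T n (adj x * x) = f (adj (x * d n) * (x * d n))"
            by (simp add: T_def adj_mult d mult.assoc)
          then show ?thesis using f by (simp add: positive_functional_def)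
        qed
      qed
    qed
    show "exchangeable (Blinfun L)"
      unfolding exchangeable_def
    proof (intro allI impI, elim conjE)
      fix js js' :: "'j list" and As :: "(complex^2^2) list"
      assume *: "distinct js" "distinct js'" "set js \<subseteq> J" "set js' \<subseteq> J"
        "length js = length As" "length js' = length As"
      obtain k where k: "k \<in> J" "k \<notin> set js \<union> set js'"
        using infinite_J by (metis finite_UnI finite_set infinite_super subsetI)
      then show "Blinfun L (mon js As) = Blinfun L (mon js' As)"
        using * \<psi>_mon[of As js k] \<psi>_mon[of As js' k]
          exchangeable_mult_embed[OF ex, of js As k js' k D] by simp
    qed
  qed auto
qed

text \<open>Normalising both summands writes \<open>f\<close> as a convex combination of symmetric
  states, which extremality forces to coincide. A summand of mass 0 cannot be normalised and is
  treated separately.\<close>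

lemma extreme_proportional:
  assumes extreme: "f extreme_point_of symmetric_states J a"
    and \<psi>: "positive_functional \<psi>" "exchangeable \<psi>"
    and \<xi>: "positive_functional \<xi>" "exchangeable \<xi>"
    and sum: "f = \<psi> + \<xi>"
  shows "\<psi> x = \<psi> 1 * f x"
proof -
  have f: "f \<in> symmetric_states J a" using extreme by (simp add: extreme_point_of_def)
  then have f1: "f 1 = 1" by (simp add: symmetric_states_iff states_eq)
  \<comment> \<open>Cauchy-Schwarz against 1: a positive functional of mass 0 vanishes.\<close>
  have null: "\<theta> y = 0" if "positive_functional \<theta>" "Re (\<theta> 1) = 0" for \<theta> y
    using positive_functional_Cauchy_Schwarz[OF that(1), of 1 y] that(2) by simp
  define s where "s = Re (\<psi> 1)"
  have \<psi>1: "\<psi> 1 = of_real s"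
    using positive_functional_Im[OF \<psi>(1), of 1] by (simp add: s_def complex_eq_iff)
  have \<xi>1: "\<xi> 1 = of_real (1 - s)"
    using f1 unfolding sum by (simp add: blinfun.add_left \<psi>1 algebra_simps)
  have s01: "0 \<le> s" "s \<le> 1"
    using positive_functional_Re_nonneg[OF \<psi>(1), of 1] positive_functional_Re_nonneg[OF \<xi>(1), of 1]
    by (simp_all add: \<psi>1 \<xi>1)
  have f_eq: "f y = \<psi> y + \<xi> y" for y by (simp add: sum blinfun.add_left)
  consider "s = 0" | "s = 1" | "0 < s" "s < 1" using s01 by linarith
  then show ?thesis
  proof cases
    case 1
    then show ?thesis using null[OF \<psi>(1), of x] by (simp add: \<psi>1)
  next
    case 2
    then show ?thesis using null[OF \<xi>(1), of x] by (simp add: \<psi>1 \<xi>1 f_eq)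
  next
    case 3
    have scaled: "(1 / t) *\<^sub>R \<theta> \<in> symmetric_states J a"
      if "positive_functional \<theta>" "exchangeable \<theta>" "\<theta> 1 = of_real t" "0 < t" for \<theta> t
      unfolding symmetric_states_iff states_def
    proof (intro conjI CollectI allI)
      show "blinfun_apply ((1 / t) *\<^sub>R \<theta>) (c *\<^sub>C y) = c * blinfun_apply ((1 / t) *\<^sub>R \<theta>) y" for c y
        by (simp add: blinfun.scaleR_left positive_functional_scaleC[OF that(1)])
      show "blinfun_apply ((1 / t) *\<^sub>R \<theta>) (adj y * y) \<in> \<real>\<^sub>\<ge>\<^sub>0" for y
        using that positive_functional_Re_nonneg[OF that(1), of y] positive_functional_Im[OF that(1), of y]
        by (simp add: blinfun.scaleR_left complex_nonneg_Reals_iff)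
      show "blinfun_apply ((1 / t) *\<^sub>R \<theta>) 1 = 1"
        using that by (simp add: blinfun.scaleR_left scaleR_conv_of_real)
      show "exchangeable ((1 / t) *\<^sub>R \<theta>)"
        using that(2) by (simp add: exchangeable_def blinfun.scaleR_left)
    qed
    define g h where "g = (1 / s) *\<^sub>R \<psi>" and "h = (1 / (1 - s)) *\<^sub>R \<xi>"
    have gh: "g \<in> symmetric_states J a" "h \<in> symmetric_states J a"
      unfolding g_def h_def using \<psi> \<xi> \<psi>1 \<xi>1 3 by (auto intro: scaled)
    \<comment> \<open>The weights are written with segment parameter \<open>1 - s\<close>, to match
      \<open>in_segment\<close>.\<close>
    have comb: "f = (1 - (1 - s)) *\<^sub>R g + (1 - s) *\<^sub>R h"
      using 3 by (simp add: g_def h_def sum)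
    have "f \<notin> open_segment g h"
      using extreme gh by (auto simp: extreme_point_of_def)
    then have "g = h" using comb 3 unfolding in_segment by (metis diff_gt_0_iff_gt diff_less_eq
      less_add_same_cancel1)
    then have "f = g" unfolding comb by (simp add: scaleR_add_left[symmetric])
    then have "\<psi> = s *\<^sub>R f" using 3 by (simp add: g_def)
    then show ?thesis by (simp add: blinfun.scaleR_left scaleR_conv_of_real f1)
  qed
qed

section \<open>Factorisation of extreme states\<close>

text \<open>The cut-downs by \<open>D\<close> and its complement \<open>D'\<close> add up to
  \<open>f\<close>, so the first is a multiple of \<open>f\<close>.\<close>

lemma extreme_diagonal_factor:
  assumes extreme: "f extreme_point_of symmetric_states J a"
    and D: "D = vector [vector [0, 0], vector [0, 1]] \<or> D = vector [vector [1, 0], vector [0, 0]]"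
    and js: "length As = length js" "distinct js" "set js \<subseteq> J" and k: "k \<in> J" "k \<notin> set js"
  shows "f (mon js As * car_embed a k D) = f (mon js As) * f (car_embed a k D)"
proof -
  have f: "positive_functional f" "f 1 = 1" "exchangeable f"
    using extreme by (auto simp: extreme_point_of_def symmetric_states_iff states_eq)
  define D' :: "complex^2^2" where "D' = mat 1 - D"
  have m1: "(mat 1 :: complex^2^2) = vector [vector [1, 0], vector [0, 1]]"
    by (simp add: vec_eq_iff mat_def forall_2)
  have D': "D' = vector [vector [0, 0], vector [0, 1]] \<or> D' = vector [vector [1, 0], vector [0, 0]]"
    using D unfolding D'_def m1 by (auto simp: vec_eq_iff forall_2)
  obtain \<psi> where \<psi>: "positive_functional \<psi>" "exchangeable \<psi>"
    "\<And>js As k. length As = length js \<Longrightarrow> distinct js \<Longrightarrow> set js \<subseteq> J \<Longrightarrow> k \<in> J \<Longrightarrow>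
      k \<notin> set js \<Longrightarrow> \<psi> (mon js As) = f (mon js As * car_embed a k D)"
    using cut_down_functional[OF f(1,3) D] by blast
  obtain \<xi> where \<xi>: "positive_functional \<xi>" "exchangeable \<xi>"
    "\<And>js As k. length As = length js \<Longrightarrow> distinct js \<Longrightarrow> set js \<subseteq> J \<Longrightarrow> k \<in> J \<Longrightarrow>
      k \<notin> set js \<Longrightarrow> \<xi> (mon js As) = f (mon js As * car_embed a k D')"
    using cut_down_functional[OF f(1,3) D'] by blast
  have "f = \<psi> + \<xi>"
  proof (rule blinfun_eqI, rule functional_eqI)
    fix js :: "'j list" and As :: "(complex^2^2) list"
    assume *: "length As = length js" "distinct js" "set js \<subseteq> J"
    obtain k where k: "k \<in> J" "k \<notin> set js"
      using infinite_J by (meson finite_set infinite_super subsetI)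
    have "car_embed a k D + car_embed a k D' = 1"
      unfolding embed_add[symmetric] by (simp add: D'_def embed_one k)
    then have "f (mon js As * car_embed a k D) + f (mon js As * car_embed a k D') = f (mon js As)"
      by (simp add: blinfun.add_right[symmetric] distrib_left[symmetric])
    then show "f (mon js As) = (\<psi> + \<xi>) (mon js As)"
      using \<psi>(3)[OF * k] \<xi>(3)[OF * k] by (simp add: blinfun.add_left)
  qed (rule blinfun.bounded_linear_right
      | simp add: blinfun.add_left positive_functional_scaleC f \<psi>(1) \<xi>(1) distrib_left)+
  \<comment> \<open>The empty monomial identifies the constant \<open>\<psi> 1\<close> with
    \<open>f (car_embed a k D)\<close>.\<close>
  from extreme_proportional[OF extreme \<psi>(1,2) \<xi>(1,2) this, of "mon js As"]
  show ?thesis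
    using \<psi>(3)[OF js k] \<psi>(3)[of "[]" "[]" k] k by (simp add: mult.commute)
qed

text \<open>The matrix is expanded in matrix units: off-diagonal ones contribute 0 to both sides,
  diagonal ones factor off.\<close>

lemma extreme_last_factor:
  assumes extreme: "f extreme_point_of symmetric_states J a"
    and js: "length As = length js" "distinct js" "set js \<subseteq> J" and k: "k \<in> J" "k \<notin> set js"
  shows "f (mon js As * car_embed a k A) = f (mon js As) * f (car_embed a k A)"
proof -
  have f: "positive_functional f" "f 1 = 1" "exchangeable f"
    using extreme by (auto simp: extreme_point_of_def symmetric_states_iff states_eq)
  note C = positive_functional_scaleC[OF f(1)]
  have odd: "f (mon js As * a k) = 0" "f (mon js As * adj (a k)) = 0" "f (a k) = 0" "f (adj (a k)) = 0"
    using generator_factor_vanishes[OF f js(2,3) js(1)[symmetric] k]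
      generator_factor_vanishes[OF f, of "[]" "[]" k] k by simp_all
  have diag: "f (mon js As * (a k * adj (a k))) = f (mon js As) * f (a k * adj (a k))"
    "f (mon js As * num k) = f (mon js As) * f (num k)"
    using extreme_diagonal_factor[OF extreme disjI2[OF refl] js k]
      extreme_diagonal_factor[OF extreme disjI1[OF refl] js k] by (simp_all only: embed_units)
  have "f (mon js As * car_embed a k A) = A$1$1 * (f (mon js As) * f (a k * adj (a k)))
      + A$2$2 * (f (mon js As) * f (num k))"
    by (simp only: car_embed_def distrib_left mult_scaleC_right blinfun.add_right C odd diag
        mult_zero_right add_0_right)
  moreover have "f (car_embed a k A) = A$1$1 * f (a k * adj (a k)) + A$2$2 * f (num k)"
    by (simp only: car_embed_def blinfun.add_right C odd mult_zero_right add_0_right)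
  ultimately show ?thesis by (simp only: distrib_left mult.left_commute)
qed

text \<open>The matrix state is the restriction of \<open>f\<close> to one site, the same at every
  site by exchangeability. It is even because \<open>f\<close> vanishes on \<open>a j0\<close> and
  its adjoint.\<close>

lemma extreme_is_product_state:
  assumes extreme: "f extreme_point_of symmetric_states J a"
  shows "\<exists>\<rho>. even_matrix_state \<rho> \<and> is_product_state J a \<rho> f"
proof -
  have f: "positive_functional f" "f 1 = 1" "exchangeable f" and f_states: "f \<in> states"
    using extreme by (auto simp: extreme_point_of_def symmetric_states_iff states_eq)
  note C = positive_functional_scaleC[OF f(1)]
  obtain j0 where j0: "j0 \<in> J" using infinite_imp_nonempty[OF infinite_J] by blast
  define \<rho> where "\<rho> A = f (car_embed a j0 A)" for A
  have \<rho>: "f (car_embed a k A) = \<rho> A" if "k \<in> J" for k A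
    using exchangeableD[OF f(3), of "[k]" "[j0]" "[A]"] that j0 by (simp add: \<rho>_def)
  have "matrix_state \<rho>"
    unfolding matrix_state_def
  proof (intro conjI allI)
    show "\<rho> (matrix_adj A ** A) \<in> \<real>\<^sub>\<ge>\<^sub>0" for A
    proof -
      have "car_embed a j0 (matrix_adj A ** A) = adj (car_embed a j0 A) * car_embed a j0 A"
        by (simp only: embed_mult[OF j0] embed_adj)
      then show ?thesis using f(1) by (simp add: \<rho>_def positive_functional_def)
    qed
  qed (simp_all add: \<rho>_def embed_add embed_scaleC embed_one j0 f C blinfun.add_right)
  moreover have "\<rho> \<circ> matrix_grading = \<rho>"
  proof
    have "f (a j0) = 0" "f (adj (a j0)) = 0"
      using generator_factor_vanishes[OF f, of "[]" "[]" j0] j0 by simp_all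
    then show "(\<rho> \<circ> matrix_grading) A = \<rho> A" for A
      by (simp add: \<rho>_def car_embed_def matrix_grading_def blinfun.add_right C)
  qed
  moreover have "f (mon js As) = prod_list (map \<rho> As)"
    if "distinct js" "set js \<subseteq> J" "length As = length js" for js As
    using that
  \<comment> \<open>Induction runs from the right end, since it is the last factor that splits
    off.\<close>
  proof (induction js arbitrary: As rule: rev_induct)
    case Nil
    then show ?case by (simp add: f)
  next
    case (snoc k js)
    obtain As' A where As: "As = As' @ [A]" using snoc.prems(3) by (cases As rule: rev_cases) auto
    have len: "length As' = length js" using snoc.prems As by simp
    have "f (mon (js @ [k]) As) = f (mon js As' * car_embed a k A)"
      by (simp add: As mon_append len)
    also have "\<dots> = f (mon js As') * \<rho> A"
      using extreme_last_factor[OF extreme len, of k A] snoc.prems \<rho>[of k A] by simp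
    also have "f (mon js As') = prod_list (map \<rho> As')"
      using snoc len by simp
    finally show ?case by (simp add: As)
  qed
  ultimately show ?thesis
    using f_states unfolding even_matrix_state_def is_product_state_def mon_def by blast
qed

end

theorem theorem6p1:
  fixes J :: "'j set"
    and a :: "'j \<Rightarrow> 'a::cstar_algebra"
    and \<phi> :: "'a \<Rightarrow>\<^sub>L complex"
  assumes "uncountable J"
    and "CAR J a"
    and "\<phi> \<in> symmetric_states J a"
  shows "\<phi> extreme_point_of symmetric_states J a \<longleftrightarrow>
    (\<exists>\<rho>. even_matrix_state \<rho> \<and> is_product_state J a \<rho> \<phi>)"
proof -
  interpret car J a
    using assms by unfold_locales (auto simp: uncountable_infinite)
  show ?thesis
    using extreme_is_product_state[of \<phi>] product_state_extreme[OF _ assms(3)] by blast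
qed

end
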